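(* Let $m\ge 3$ and let $\chi$ be a primitive Dirichlet character modulo $2^m$. Let $q\ge 1$ be odd and $n\ge 1$. If $k\ge 0$ is an integer with $\chi(-1)\neq(-1)^k$, then $$\mathcal{L}_{k+2^n q,\chi}-\mathcal{L}_{k,\chi}\equiv \frac{2^{n+2}}{1-\bar\chi(5)}\cdot \mathcal{L}_{d,\chi}\pmod{2^{n+3}},$$ where $d\in\{0,1\}$ is such that $k\equiv d\pmod 2$. In particular, for integers $k,l\ge 0$ with $\chi(-1)\ne(-1)^k$ and $\chi(-1)\ne(-1)^l$, we have $\mathcal{L}_{k,\chi}\equiv\mathcal{L}_{l,\chi}\pmod{2^{n+2}}$ if and only if $k\equiv l\pmod{2^n}$.
   Context: For a Dirichlet character $\chi$, $L(s,\chi)=\sum_{n\ge1}\chi(n)n^{-s}$ (analytically continued); for integers $k\ge 0$ one has $L(-k,\chi)=-B_{k+1,\chi}/(k+1)$, where the generalized Bernoulli numbers for $\chi$ modulo $f$ are given by $\sum_{k\ge0}B_{k,\chi}t^k/k!=\sum_{a=1}^{f}\chi(a)\,te^{at}/(e^{ft}-1)$. "$k$ has the opposite parity as $\chi$" means $\chi(-1)\ne(-1)^k$. For $\chi$ of conductor $2^m$ with $m\ge3$, define $\mathcal{L}_{k,\chi}=(1-\chi(5))L(-k,\chi)$. $\bar\chi$ denotes the complex conjugate character. All quantities lie in the cyclotomic field generated by the values of $\chi$; a congruence $x\equiv y\pmod{2^r}$ means $(x-y)/2^r$ is integral at every prime above $2$ (i.e. lies in the localization of the ring of algebraic integers at the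 primes above $2$). *)

theory Defs
  imports Complex_Main "HOL-Computational_Algebra.Computational_Algebra"
    "HOL-Number_Theory.Number_Theory"
begin

definition dirichlet_char :: "nat \<Rightarrow> (int \<Rightarrow> complex) \<Rightarrow> bool" where
  "dirichlet_char N \<chi> \<longleftrightarrow> N > 0 \<and>
     (\<forall>a. \<chi> (a + int N) = \<chi> a) \<and>
     (\<forall>a b. \<chi> (a * b) = \<chi> a * \<chi> b) \<and>
     (\<forall>a. \<chi> a \<noteq> 0 \<longleftrightarrow> coprime a (int N))"

definition primitive_char :: "nat \<Rightarrow> (int \<Rightarrow> complex) \<Rightarrow> bool" where
  "primitive_char N \<chi> \<longleftrightarrow> dirichlet_char N \<chi> \<and>
     \<not> (\<exists>d::nat. d dvd N \<and> d < N \<and>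
          (\<forall>a. coprime a (int N) \<and> [a = 1] (mod int d) \<longrightarrow> \<chi> a = 1))"

definition gen_bernoulli_fps :: "nat \<Rightarrow> (int \<Rightarrow> complex) \<Rightarrow> complex fps" where
  "gen_bernoulli_fps f \<chi> =
     (\<Sum>a=1..f. fps_const (\<chi> (int a)) * (fps_X * fps_exp (of_nat a))
                   / (fps_exp (of_nat f) - 1))"

definition gen_bernoulli :: "nat \<Rightarrow> (int \<Rightarrow> complex) \<Rightarrow> nat \<Rightarrow> complex" where
  "gen_bernoulli f \<chi> k = fact k * fps_nth (gen_bernoulli_fps f \<chi>) k"

definition L_neg :: "nat \<Rightarrow> (int \<Rightarrow> complex) \<Rightarrow> nat \<Rightarrow> complex" where
  "L_neg f \<chi> k = - gen_bernoulli f \<chi> (k + 1) / of_nat (k + 1)"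

definition LL :: "nat \<Rightarrow> (int \<Rightarrow> complex) \<Rightarrow> nat \<Rightarrow> complex" where
  "LL f \<chi> k = (1 - \<chi> 5) * L_neg f \<chi> k"

text \<open>x = y mod 2^r: (x-y)/2^r is integral at every prime above 2, i.e. it
  becomes an algebraic integer after multiplication by some odd integer.\<close>
definition cong2 :: "complex \<Rightarrow> complex \<Rightarrow> nat \<Rightarrow> bool" where
  "cong2 x y r \<longleftrightarrow> (\<exists>s::int. odd s \<and> algebraic_int (of_int s * ((x - y) / 2 ^ r)))"

end

theory Submission
  imports Defs "Jordan_Normal_Form.Char_Poly"
begin

text \<open>
  Put \<open>\<zeta> = \<chi>(5)\<close>, a primitive root of unity of order \<open>2 ^ (m - 2)\<close>, so that \<open>1 - \<zeta>\<close> divides 2.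
  Multiplying \<open>L(-k, \<chi>)\<close> by \<open>1 - 5 ^ (k + 1) \<zeta>\<close> removes the pole of the generating function and leaves
  \<open>G k\<close>, the integral of \<open>\<chi>(x) x ^ k\<close> against a 2-adic measure on the odd integers: modulo \<open>F = 2 ^ N\<close>
  it is the sum over \<open>b < F\<close> of \<open>\<chi>(5 b) (5 b) ^ k (\<lfloor>5 b / F\<rfloor> - 2)\<close>. By the parity condition the
  summand is invariant under \<open>b \<mapsto> F - b\<close>, so \<open>G k / 2\<close> is integral, and it depends on \<open>k\<close> only
  modulo \<open>2 ^ n\<close> up to a multiple of \<open>2 ^ (n + 2)\<close>. Counting the odd \<open>b\<close> between \<open>F / 5\<close> and
  \<open>2 F / 5\<close> shows that \<open>G k / 2\<close> is 1 modulo \<open>1 - \<zeta>\<close>. Hence the variation of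
  \<open>(1 - \<zeta>) L(-k, \<chi>) = (1 - \<zeta>) / (1 - 5 ^ (k + 1) \<zeta>) * G k\<close> is governed by its denominator, where
  \<open>5 ^ (2 ^ n q) = 1 + 2 ^ (n + 2)\<close> modulo \<open>2 ^ (n + 3)\<close>.
\<close>

section \<open>Algebraic integers localized at 2\<close>

definition zspan :: "complex set \<Rightarrow> complex set" where
  "zspan B = range (\<lambda>c :: complex \<Rightarrow> int. \<Sum>b\<in>B. of_int (c b) * b)"

lemma zspanI: "x = (\<Sum>b\<in>B. of_int (c b) * b) \<Longrightarrow> x \<in> zspan B"
  unfolding zspan_def by blast

lemma zspan_base:
  assumes "finite B" "b \<in> B"
  shows "b \<in> zspan B"
proof -
  have "(\<Sum>x\<in>B. of_int (if x = b then 1 else 0) * x) = (\<Sum>x\<in>B. if x = b then x else 0)"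
    by (intro sum.cong) auto
  also have "\<dots> = b"
    using assms by simp
  finally show ?thesis
    by (rule zspanI[OF sym])
qed

lemma zspan_0: "0 \<in> zspan B"
  by (rule zspanI[of _ "\<lambda>_. 0"]) simp

lemma zspan_add:
  assumes "x \<in> zspan B" "y \<in> zspan B"
  shows "x + y \<in> zspan B"
proof -
  obtain c d where "x = (\<Sum>b\<in>B. of_int (c b) * b)" "y = (\<Sum>b\<in>B. of_int (d b) * b)"
    using assms unfolding zspan_def by auto
  then have "x + y = (\<Sum>b\<in>B. of_int (c b + d b) * b)"
    by (simp add: sum.distrib algebra_simps)
  then show ?thesis
    by (rule zspanI)
qed

lemma zspan_of_int_mult:
  assumes "x \<in> zspan B"
  shows "of_int a * x \<in> zspan B"
proof -
  obtain c where "x = (\<Sum>b\<in>B. of_int (c b) * b)"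
    using assms unfolding zspan_def by auto
  then have "of_int a * x = (\<Sum>b\<in>B. of_int (a * c b) * b)"
    by (simp add: sum_distrib_left algebra_simps)
  then show ?thesis
    by (rule zspanI)
qed

lemma zspan_sum: "(\<And>i. i \<in> I \<Longrightarrow> f i \<in> zspan B) \<Longrightarrow> sum f I \<in> zspan B"
  by (induction I rule: infinite_finite_induct) (auto intro: zspan_0 zspan_add)

lemma zspan_mult_closed:
  assumes "\<And>b. b \<in> B \<Longrightarrow> z * b \<in> zspan B" "x \<in> zspan B"
  shows "z * x \<in> zspan B"
proof -
  obtain c where x: "x = (\<Sum>b\<in>B. of_int (c b) * b)"
    using assms(2) unfolding zspan_def by auto
  have "z * x = (\<Sum>b\<in>B. of_int (c b) * (z * b))"
    unfolding x by (simp add: sum_distrib_left algebra_simps)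
  then show ?thesis
    using assms(1) by (auto intro!: zspan_sum zspan_of_int_mult)
qed

text \<open>The determinant trick: multiplication by \<open>z\<close> acts on \<open>B\<close>
  through an integer matrix, and listing the elements of \<open>B\<close> gives an eigenvector for
  \<open>z\<close>, nonzero because \<open>1 \<in> B\<close>. So \<open>z\<close> is a root of a
  monic integer characteristic polynomial; \<open>B\<close> may be linearly dependent.\<close>

lemma algebraic_int_if_stable:
  assumes "finite B" "1 \<in> B" "\<And>b. b \<in> B \<Longrightarrow> z * b \<in> zspan B"
  shows "algebraic_int z"
proof -
  obtain v where v: "bij_betw v {0..<card B} B"
    using ex_bij_betw_nat_finite[OF assms(1)] by blast
  define n where "n = card B"
  have "\<forall>b\<in>B. \<exists>c :: complex \<Rightarrow> int. z * b = (\<Sum>x\<in>B. of_int (c x) * x)"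
    using assms(3) unfolding zspan_def by fastforce
  then obtain c :: "complex \<Rightarrow> complex \<Rightarrow> int"
    where c: "\<And>b. b \<in> B \<Longrightarrow> z * b = (\<Sum>x\<in>B. of_int (c b x) * x)"
    by metis
  define M where "M = mat n n (\<lambda>(i, j). c (v i) (v j))"
  define Mc where "Mc = map_mat (of_int :: int \<Rightarrow> complex) M"
  have M: "M \<in> carrier_mat n n" and Mc: "Mc \<in> carrier_mat n n"
    by (auto simp: M_def Mc_def)
  have vB: "v i \<in> B" if "i < n" for i
    using v that by (auto simp: n_def bij_betw_def)
  obtain i0 where i0: "i0 < n" "v i0 = 1"
    using v assms(2) unfolding n_def bij_betw_def by (metis atLeastLessThan_iff imageE)
  have "eigenvector Mc (vec n v) z"
    unfolding eigenvector_def
  proof (intro conjI)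
    show "vec n v \<in> carrier_vec (dim_row Mc)"
      using Mc by auto
    show "vec n v \<noteq> 0\<^sub>v (dim_row Mc)"
    proof
      assume "vec n v = 0\<^sub>v (dim_row Mc)"
      then have "vec_index (vec n v) i0 = vec_index (0\<^sub>v n) i0"
        using Mc by auto
      with i0 show False by simp
    qed
    show "Mc *\<^sub>v vec n v = z \<cdot>\<^sub>v vec n v"
    proof (rule eq_vecI)
      fix i assume "i < dim_vec (z \<cdot>\<^sub>v vec n v)"
      then have i: "i < n" by simp
      have "vec_index (Mc *\<^sub>v vec n v) i = (\<Sum>j\<in>{0..<n}. of_int (c (v i) (v j)) * v j)"
        using i Mc by (simp add: scalar_prod_def Mc_def M_def)
      also have "\<dots> = z * v i"
        unfolding c[OF vB[OF i]] using sum.reindex_bij_betw[OF v] by (simp add: n_def)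
      finally show "vec_index (Mc *\<^sub>v vec n v) i = vec_index (z \<cdot>\<^sub>v vec n v) i"
        using i by simp
    qed (use Mc in auto)
  qed
  then have "eigenvalue Mc z"
    unfolding eigenvalue_def by blast
  then have "poly (char_poly Mc) z = 0"
    using eigenvalue_root_char_poly[OF Mc] by blast
  moreover have "char_poly Mc = map_poly of_int (char_poly M)"
    unfolding Mc_def by (rule of_int_hom.char_poly_hom[OF M])
  ultimately show ?thesis
    unfolding algebraic_int_altdef_ipoly
    using degree_monic_char_poly[OF M] by auto
qed

lemma algebraic_int_power_reduction:
  fixes x :: complex
  assumes "algebraic_int x"
  obtains a :: nat and p :: "nat \<Rightarrow> int"
  where "a > 0" "x ^ a = (\<Sum>i<a. of_int (p i) * x ^ i)"
proof -
  obtain p :: "int poly" where p: "poly (map_poly of_int p) x = 0" "lead_coeff p = 1"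
    using assms unfolding algebraic_int_altdef_ipoly by auto
  define a where "a = Polynomial.degree p"
  have "0 = (\<Sum>i\<le>a. of_int (Polynomial.coeff p i) * x ^ i)"
    using p(1) by (simp add: poly_altdef degree_map_poly coeff_map_poly a_def)
  also have "\<dots> = (\<Sum>i<a. of_int (Polynomial.coeff p i) * x ^ i) + x ^ a"
    using p(2) by (simp add: a_def flip: lessThan_Suc_atMost)
  finally have *: "x ^ a = (\<Sum>i<a. of_int (- Polynomial.coeff p i) * x ^ i)"
    by (simp add: sum_negf eq_neg_iff_add_eq_0 add.commute)
  \<comment> \<open>In degree 0 the relation would read 1 = 0.\<close>
  moreover have "a > 0"
    using * by (cases a) auto
  ultimately show ?thesis
    using that[of a "\<lambda>i. - Polynomial.coeff p i"] by blast
qed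

text \<open>The finitely many monomials \<open>x ^ i * y ^ j\<close> below both degrees span a group
  stable under multiplication by \<open>x\<close> and by \<open>y\<close>, hence by their sum and
  product.\<close>

lemma algebraic_int_add_mult:
  fixes x y :: complex
  assumes "algebraic_int x" "algebraic_int y"
  shows "algebraic_int (x + y)" "algebraic_int (x * y)"
proof -
  obtain a p where a: "a > 0" "x ^ a = (\<Sum>i<a. of_int (p i) * x ^ i)"
    using algebraic_int_power_reduction[OF assms(1)] by blast
  obtain b q where b: "b > 0" "y ^ b = (\<Sum>j<b. of_int (q j) * y ^ j)"
    using algebraic_int_power_reduction[OF assms(2)] by blast
  define B where "B = (\<lambda>(i, j). x ^ i * y ^ j) ` ({..<a} \<times> {..<b})"
  have fin: "finite B"
    by (simp add: B_def)
  have inB: "x ^ i * y ^ j \<in> zspan B" if "i < a" "j < b" for i j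
    using that by (intro zspan_base[OF fin]) (auto simp: B_def)
  have x: "x * w \<in> zspan B" if w: "w \<in> B" for w
  proof -
    obtain i j where ij: "i < a" "j < b" "w = x ^ i * y ^ j"
      using w by (auto simp: B_def)
    show ?thesis
    proof (cases "Suc i < a")
      case True
      then show ?thesis
        using inB[of "Suc i" j] ij by (simp add: algebra_simps)
    next
      case False
      then have "x * w = x ^ a * y ^ j"
        using ij by (metis Suc_lessI mult.assoc power_Suc)
      also have "\<dots> = (\<Sum>i<a. of_int (p i) * (x ^ i * y ^ j))"
        unfolding a(2) by (simp add: sum_distrib_right mult.assoc)
      finally show ?thesis
        using inB ij by (auto intro!: zspan_sum zspan_of_int_mult)
    qed
  qed
  have y: "y * w \<in> zspan B" if w: "w \<in> B" for w
  proof -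
    obtain i j where ij: "i < a" "j < b" "w = x ^ i * y ^ j"
      using w by (auto simp: B_def)
    show ?thesis
    proof (cases "Suc j < b")
      case True
      then show ?thesis
        using inB[of i "Suc j"] ij by (simp add: algebra_simps)
    next
      case False
      then have "y * w = x ^ i * y ^ b"
        using ij by (metis Suc_lessI mult.left_commute power_Suc)
      also have "\<dots> = (\<Sum>j<b. of_int (q j) * (x ^ i * y ^ j))"
        unfolding b(2) by (simp add: sum_distrib_left algebra_simps)
      finally show ?thesis
        using inB ij by (auto intro!: zspan_sum zspan_of_int_mult)
    qed
  qed
  have one: "1 \<in> B"
    unfolding B_def using a(1) b(1) by (intro image_eqI[of _ _ "(0, 0)"]) auto
  show "algebraic_int (x + y)"
    using x y by (intro algebraic_int_if_stable[OF fin one]) (auto simp: distrib_right intro: zspan_add)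
  show "algebraic_int (x * y)"
    using x y by (intro algebraic_int_if_stable[OF fin one])
      (auto simp: mult.assoc intro: zspan_mult_closed)
qed

lemma algebraic_int_root_of_unity:
  fixes x :: complex
  assumes "x ^ n = 1" "n > 0"
  shows "algebraic_int x"
proof (rule algebraic_int_root[of 1 "Polynomial.monom 1 n"])
  show "\<forall>i. Polynomial.coeff (Polynomial.monom 1 n) i \<in> (\<int> :: complex set)"
    by simp
qed (use assms in \<open>auto simp: poly_monom Polynomial.degree_monom_eq int_imp_algebraic_int\<close>)

text \<open>The ring in which \<^const>\<open>cong2\<close> is congruence modulo \<open>2 ^ r\<close>:
  the algebraic integers localized at the odd rational integers.\<close>
definition int2 :: "complex set" where
  "int2 = {x. \<exists>s::int. odd s \<and> algebraic_int (of_int s * x)}"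

lemma cong2_iff: "cong2 x y r \<longleftrightarrow> (x - y) / 2 ^ r \<in> int2"
  by (simp add: cong2_def int2_def)

lemma int2_algebraic_int: "algebraic_int x \<Longrightarrow> x \<in> int2"
  unfolding int2_def by (auto intro!: exI[of _ 1])

lemma int2_of_int [simp]: "of_int a \<in> int2"
  by (intro int2_algebraic_int int_imp_algebraic_int) auto

lemma int2_of_nat [simp]: "of_nat a \<in> int2"
  using int2_of_int[of "int a"] by simp

lemma int2_0 [simp]: "0 \<in> int2"
  using int2_of_int[of 0] by simp

lemma int2_1 [simp]: "1 \<in> int2"
  using int2_of_int[of 1] by simp

lemma int2_numeral [simp]: "numeral a \<in> int2"
  using int2_of_int[of "numeral a"] by simp

lemma int2_mult [simp, intro]:
  assumes "x \<in> int2" "y \<in> int2"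
  shows "x * y \<in> int2"
proof -
  obtain s t where st: "odd s" "algebraic_int (of_int s * x)" "odd t" "algebraic_int (of_int t * y)"
    using assms unfolding int2_def by auto
  have "of_int (s * t) * (x * y) = (of_int s * x) * (of_int t * y)"
    by simp
  then have "algebraic_int (of_int (s * t) * (x * y))"
    using st algebraic_int_add_mult by metis
  moreover have "odd (s * t)"
    using st by simp
  ultimately show ?thesis
    unfolding int2_def by blast
qed

lemma int2_add [simp, intro]:
  assumes "x \<in> int2" "y \<in> int2"
  shows "x + y \<in> int2"
proof -
  obtain s t where st: "odd s" "algebraic_int (of_int s * x)" "odd t" "algebraic_int (of_int t * y)"
    using assms unfolding int2_def by auto
  have "of_int (s * t) * (x + y) = of_int t * (of_int s * x) + of_int s * (of_int t * y)"
    by (simp add: algebra_simps)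
  moreover have "algebraic_int (of_int a :: complex)" for a
    by (simp add: int_imp_algebraic_int)
  ultimately have "algebraic_int (of_int (s * t) * (x + y))"
    using st algebraic_int_add_mult by metis
  moreover have "odd (s * t)"
    using st by simp
  ultimately show ?thesis
    unfolding int2_def by blast
qed

lemma int2_uminus [simp, intro]: "x \<in> int2 \<Longrightarrow> - x \<in> int2"
  using int2_mult[of "of_int (-1)" x] int2_of_int[of "-1"] by simp

lemma int2_diff [simp, intro]: "x \<in> int2 \<Longrightarrow> y \<in> int2 \<Longrightarrow> x - y \<in> int2"
  using int2_add[of x "- y"] by auto

lemma int2_power [simp, intro]: "x \<in> int2 \<Longrightarrow> x ^ n \<in> int2"
  by (induction n) auto

lemma int2_sum [intro]: "(\<And>i. i \<in> I \<Longrightarrow> f i \<in> int2) \<Longrightarrow> sum f I \<in> int2"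
  by (induction I rule: infinite_finite_induct) auto

lemma int2_divide_odd [simp, intro]:
  assumes "x \<in> int2" "odd s"
  shows "x / of_int s \<in> int2"
proof -
  have "algebraic_int (of_int s * (1 / of_int s) :: complex)"
    using assms by (cases "s = 0") auto
  then have "1 / of_int s \<in> int2"
    unfolding int2_def using assms by blast
  then show ?thesis
    using int2_mult[OF assms(1)] by fastforce
qed

text \<open>An odd multiple of 1/2 is rational but not an integer, so it is no algebraic integer.
  All non-congruences below rest on this.\<close>

lemma half_notin_int2: "1 / 2 \<notin> int2"
proof
  assume "1 / 2 \<in> int2"
  then obtain s :: int where s: "odd s" "algebraic_int (of_int s * (1 / 2) :: complex)"
    unfolding int2_def by auto
  moreover have "of_int s * (1 / 2) \<in> (\<rat> :: complex set)"
    by (intro Rats_mult Rats_divide) auto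
  ultimately have "of_int s * (1 / 2) \<in> (\<int> :: complex set)"
    using rational_algebraic_int_is_int by blast
  then obtain t where "of_int s * (1 / 2) = (of_int t :: complex)"
    by (auto elim: Ints_cases)
  then have "(of_int s :: complex) = of_int (2 * t)"
    by (simp add: field_simps)
  then have "s = 2 * t"
    by (simp only: of_int_eq_iff)
  with s show False
    by simp
qed

text \<open>Extends \<open>cong2\<close> to moduli such as \<open>1 - \<zeta>\<close>, and to
  arguments that need not be integral.\<close>

definition cong_int2 :: "complex \<Rightarrow> complex \<Rightarrow> complex \<Rightarrow> bool" where
  "cong_int2 c x y \<longleftrightarrow> (\<exists>z\<in>int2. x = y + c * z)"

lemma cong_int2I: "x = y + c * z \<Longrightarrow> z \<in> int2 \<Longrightarrow> cong_int2 c x y"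
  unfolding cong_int2_def by blast

lemma cong_int2E:
  assumes "cong_int2 c x y"
  obtains z where "z \<in> int2" "x = y + c * z"
  using assms unfolding cong_int2_def by blast

lemma cong2_iff_cong_int2: "cong2 x y r \<longleftrightarrow> cong_int2 (2 ^ r) x y"
proof
  assume "cong2 x y r"
  then show "cong_int2 (2 ^ r) x y"
    by (intro cong_int2I[of _ _ _ "(x - y) / 2 ^ r"]) (auto simp: cong2_iff)
qed (auto simp: cong2_iff elim!: cong_int2E)

lemma cong_int2_refl [simp]: "cong_int2 c x x"
  by (rule cong_int2I[of _ _ _ 0]) auto

lemma cong_int2_trans [trans]:
  assumes "cong_int2 c x y" "cong_int2 c y z"
  shows "cong_int2 c x z"
proof -
  obtain u v where "u \<in> int2" "x = y + c * u" "v \<in> int2" "y = z + c * v"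
    using assms by (auto elim!: cong_int2E)
  then show ?thesis
    by (intro cong_int2I[of _ _ _ "u + v"]) (auto simp: algebra_simps)
qed

lemma cong_int2_sym:
  assumes "cong_int2 c x y"
  shows "cong_int2 c y x"
proof -
  obtain u where "u \<in> int2" "x = y + c * u"
    using assms by (auto elim!: cong_int2E)
  then show ?thesis
    by (intro cong_int2I[of _ _ _ "- u"]) auto
qed

lemma cong_int2_add:
  assumes "cong_int2 c x x'" "cong_int2 c y y'"
  shows "cong_int2 c (x + y) (x' + y')"
proof -
  obtain u v where "u \<in> int2" "x = x' + c * u" "v \<in> int2" "y = y' + c * v"
    using assms by (auto elim!: cong_int2E)
  then show ?thesis
    by (intro cong_int2I[of _ _ _ "u + v"]) (auto simp: algebra_simps)
qed

text \<open>The factor \<open>d\<close> may be non-integral: with \<open>d = 1 / 2\<close> this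
  halves a congruence together with its modulus.\<close>

lemma cong_int2_scale:
  assumes "cong_int2 c x y"
  shows "cong_int2 (d * c) (d * x) (d * y)"
proof -
  obtain u where "u \<in> int2" "x = y + c * u"
    using assms by (auto elim!: cong_int2E)
  then show ?thesis
    by (intro cong_int2I[of _ _ _ u]) (auto simp: algebra_simps)
qed

lemma cong_int2_lmult:
  assumes "cong_int2 c x y" "d \<in> int2"
  shows "cong_int2 c (d * x) (d * y)"
proof -
  obtain u where "u \<in> int2" "x = y + c * u"
    using assms by (auto elim!: cong_int2E)
  then show ?thesis
    using assms(2) by (intro cong_int2I[of _ _ _ "d * u"]) (auto simp: algebra_simps)
qed

lemma cong_int2_mult:
  assumes "cong_int2 c x x'" "cong_int2 c y y'" "x \<in> int2" "y' \<in> int2"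
  shows "cong_int2 c (x * y) (x' * y')"
proof -
  have "cong_int2 c (x * y) (x * y')"
    using assms by (intro cong_int2_lmult)
  also have "cong_int2 c (y' * x) (y' * x')"
    using assms by (intro cong_int2_lmult)
  then have "cong_int2 c (x * y') (x' * y')"
    by (simp add: mult.commute)
  finally show ?thesis .
qed

lemma cong_int2_power:
  assumes "cong_int2 c x y" "x \<in> int2" "y \<in> int2"
  shows "cong_int2 c (x ^ n) (y ^ n)"
  by (induction n) (use assms in \<open>auto intro!: cong_int2_mult\<close>)

lemma cong_int2_sum:
  "(\<And>i. i \<in> I \<Longrightarrow> cong_int2 c (f i) (g i)) \<Longrightarrow> cong_int2 c (sum f I) (sum g I)"
  by (induction I rule: infinite_finite_induct) (auto intro: cong_int2_add)

lemma cong_int2_weaken: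
  assumes "cong_int2 (c * d) x y" "d \<in> int2"
  shows "cong_int2 c x y"
proof -
  obtain u where "u \<in> int2" "x = y + c * d * u"
    using assms by (auto elim!: cong_int2E)
  then show ?thesis
    using assms(2) by (intro cong_int2I[of _ _ _ "d * u"]) auto
qed

lemma cong_int2_in: "cong_int2 c x y \<Longrightarrow> c \<in> int2 \<Longrightarrow> y \<in> int2 \<Longrightarrow> x \<in> int2"
  by (auto elim!: cong_int2E)

lemma cong_int2_of_int:
  assumes "[a = b] (mod n)"
  shows "cong_int2 (of_int n) (of_int a) (of_int b)"
proof -
  obtain k where "a = b + n * k"
    using assms by (metis cong_iff_lin cong_sym)
  then show ?thesis
    by (intro cong_int2I[of _ _ _ "of_int k"]) auto
qed

section \<open>Roots of unity of 2-power order\<close>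

lemma power_two_power_Suc: "x ^ (2 ^ Suc n) = (x ^ (2 ^ n))\<^sup>2" for x :: "'a :: monoid_mult"
  by (simp only: power_Suc2 power_mult)

text \<open>Odd squares are 1 modulo 8, and each further squaring gains a factor 2.\<close>

lemma odd_power_two_power_cong_1:
  fixes a :: int
  assumes "odd a" "n \<ge> 1"
  shows "[a ^ (2 ^ n) = 1] (mod 2 ^ (n + 2))"
  using assms(2)
proof (induction n rule: dec_induct)
  case base
  obtain b where b: "a = 2 * b + 1"
    using assms(1) by (elim oddE)
  have "even (b * (b + 1))"
    by simp
  then obtain c where c: "b * (b + 1) = 2 * c"
    by (elim evenE)
  have "a ^ (2 ^ 1) - 1 = 4 * (b * (b + 1))"
    unfolding b by (simp add: power2_eq_square algebra_simps)
  then have "a ^ (2 ^ 1) - 1 = 2 ^ (1 + 2) * c"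
    unfolding c by simp
  then show ?case
    by (metis cong_iff_dvd_diff dvd_triv_left)
next
  case (step n)
  obtain t where t: "a ^ (2 ^ n) = 1 + 2 ^ (n + 2) * t"
    using step.IH by (metis cong_iff_lin cong_sym)
  have "a ^ (2 ^ Suc n) - 1 = (1 + 2 ^ (n + 2) * t)\<^sup>2 - 1"
    by (simp only: power_two_power_Suc t)
  also have "\<dots> = 2 ^ (Suc n + 2) * (t + 2 ^ (n + 1) * t\<^sup>2)"
    by (simp add: power2_eq_square algebra_simps)
  finally show ?case
    by (metis cong_iff_dvd_diff dvd_triv_left)
qed

text \<open>The case \<open>n = 0\<close> is 5 = 1 + 4. Squaring \<open>1 + 2 ^ (n + 2) * s\<close>
  with \<open>s\<close> odd doubles the middle term, and the square term is already divisible by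
  \<open>2 ^ (n + 4)\<close>.\<close>

lemma five_power_two_power_cong: "[(5::int) ^ (2 ^ n) = 1 + 2 ^ (n + 2)] (mod 2 ^ (n + 3))"
proof (induction n)
  case 0
  show ?case by (simp add: cong_def)
next
  case (Suc n)
  obtain t :: int where t: "5 ^ (2 ^ n) = 1 + 2 ^ (n + 2) + 2 ^ (n + 3) * t"
    using Suc by (metis cong_iff_lin cong_sym)
  define s where "s = 1 + 2 * t"
  have s: "5 ^ (2 ^ n) = 1 + 2 ^ (n + 2) * s"
    unfolding t s_def by (simp add: algebra_simps power_add)
  have "(5::int) ^ (2 ^ Suc n) - (1 + 2 ^ (Suc n + 2)) = (1 + 2 ^ (n + 2) * s)\<^sup>2 - (1 + 2 ^ (Suc n + 2))"
    by (simp only: power_two_power_Suc s)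
  also have "\<dots> = 2 ^ (Suc n + 3) * (t + 2 ^ n * s\<^sup>2)"
    by (simp add: power2_eq_square algebra_simps s_def power_add)
  finally show ?case
    by (metis cong_iff_dvd_diff dvd_triv_left)
qed

lemma five_power_cong:
  assumes "odd q"
  shows "[(5::int) ^ (2 ^ n * q) = 1 + 2 ^ (n + 2)] (mod 2 ^ (n + 3))"
proof -
  obtain r where r: "q = 2 * r + 1"
    using assms by (elim oddE)
  have "(5::int) ^ (2 ^ n * q) = 5 ^ (2 ^ n) * (5 ^ r) ^ (2 ^ Suc n)"
    unfolding r by (simp add: algebra_simps flip: power_mult power_add)
  moreover have "[(5 ^ r :: int) ^ (2 ^ Suc n) = 1] (mod 2 ^ (Suc n + 2))"
    by (rule odd_power_two_power_cong_1) auto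
  moreover have "Suc n + 2 = n + 3"
    by simp
  ultimately show ?thesis
    using cong_mult[OF five_power_two_power_cong[of n], of "(5 ^ r) ^ (2 ^ Suc n)" 1]
    by (simp only: mult_1_right)
qed

text \<open>By induction the square of \<open>z\<close> is a power of the square of
  \<open>\<zeta>\<close>, so \<open>z\<close> is a power of \<open>\<zeta>\<close> up to sign; the
  sign is itself a power of \<open>\<zeta>\<close>.\<close>

lemma power_of_root_if_root_of_unity:
  fixes z \<zeta> :: complex
  assumes "\<zeta> ^ (2 ^ j) = - 1" "z ^ (2 ^ Suc j) = 1"
  shows "\<exists>i. z = \<zeta> ^ i"
  using assms
proof (induction j arbitrary: z \<zeta>)
  case 0
  then have "z = 1 \<or> z = \<zeta>"
    by (simp add: power2_eq_1_iff)
  then show ?case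
    by (metis power_0 power_one_right)
next
  case (Suc j)
  have "\<exists>i. z\<^sup>2 = (\<zeta>\<^sup>2) ^ i"
    using Suc.prems by (intro Suc.IH) (simp_all flip: power_mult)
  then obtain i where "z\<^sup>2 = (\<zeta> ^ i)\<^sup>2"
    by (metis power_mult mult.commute)
  then have "z = \<zeta> ^ i \<or> z = - (\<zeta> ^ i)"
    by (simp add: power2_eq_iff)
  moreover have "- (\<zeta> ^ i) = \<zeta> ^ (2 ^ Suc j + i)"
    using Suc.prems(1) by (simp add: power_add)
  ultimately show ?case
    by metis
qed

text \<open>The single equation says that \<open>\<zeta>\<close> has exact order
  \<open>2 ^ Suc j\<close>.\<close>

locale two_power_root =
  fixes \<zeta> :: complex and j :: nat
  assumes root: "\<zeta> ^ (2 ^ j) = - 1"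
begin

lemma root_of_unity: "\<zeta> ^ (2 ^ Suc j) = 1"
  using root by (simp only: power_two_power_Suc) simp

lemma root_int2 [simp]: "\<zeta> \<in> int2"
  by (intro int2_algebraic_int algebraic_int_root_of_unity[OF root_of_unity]) simp

lemma uniformizer_dvd_2: "2 = (1 - \<zeta>) * (\<Sum>i<2 ^ j. \<zeta> ^ i)"
  using one_diff_power_eq[of \<zeta> "2 ^ j"] root by simp

lemma uniformizer_nonzero: "1 - \<zeta> \<noteq> 0"
  using uniformizer_dvd_2 by auto

lemma two_div_uniformizer: "2 / (1 - \<zeta>) \<in> int2"
proof -
  have "2 / (1 - \<zeta>) = (\<Sum>i<2 ^ j. \<zeta> ^ i)"
    by (metis nonzero_mult_div_cancel_left uniformizer_dvd_2 uniformizer_nonzero)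
  then show ?thesis
    by auto
qed

lemma cong_int2_uniformizer_if_2:
  assumes "cong_int2 2 x y"
  shows "cong_int2 (1 - \<zeta>) x y"
proof (rule cong_int2_weaken)
  show "cong_int2 ((1 - \<zeta>) * (2 / (1 - \<zeta>))) x y"
    using assms
    by (simp only: times_divide_eq_right nonzero_mult_div_cancel_left[OF uniformizer_nonzero])
qed (rule two_div_uniformizer)

text \<open>By Frobenius modulo 2, \<open>(1 - \<zeta>) ^ (2 ^ j)\<close> is congruent to
  \<open>1 + \<zeta> ^ (2 ^ j) = 0\<close>. An inverse of \<open>1 - \<zeta>\<close> would therefore
  make 1/2 integral.\<close>

lemma not_cong_int2_1_0: "\<not> cong_int2 (1 - \<zeta>) 1 0"
proof
  assume "cong_int2 (1 - \<zeta>) 1 0"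
  then obtain z where z: "z \<in> int2" "1 = (1 - \<zeta>) * z"
    by (auto elim!: cong_int2E)
  have "cong_int2 2 ((1 - \<zeta>) ^ (2 ^ i)) (1 + \<zeta> ^ (2 ^ i))" for i
  proof (induction i)
    case 0
    show ?case
      by (rule cong_int2I[of _ _ _ "- \<zeta>"]) auto
  next
    case (Suc i)
    have "cong_int2 2 (((1 - \<zeta>) ^ (2 ^ i))\<^sup>2) ((1 + \<zeta> ^ (2 ^ i))\<^sup>2)"
      using Suc by (intro cong_int2_power) auto
    moreover have "cong_int2 2 ((1 + \<zeta> ^ (2 ^ i))\<^sup>2) (1 + (\<zeta> ^ (2 ^ i))\<^sup>2)"
      by (rule cong_int2I[of _ _ _ "\<zeta> ^ (2 ^ i)"]) (auto simp: power2_eq_square algebra_simps)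
    ultimately show ?case
      unfolding power_two_power_Suc by (rule cong_int2_trans)
  qed
  from this[of j] obtain w where w: "w \<in> int2" "(1 - \<zeta>) ^ (2 ^ j) = 2 * w"
    using root by (auto elim!: cong_int2E)
  have "1 = ((1 - \<zeta>) * z) ^ (2 ^ j)"
    using z by simp
  also have "\<dots> = 2 * (w * z ^ (2 ^ j))"
    using w by (simp add: power_mult_distrib)
  finally have "1 / 2 = w * z ^ (2 ^ j)"
    by (metis nonzero_mult_div_cancel_left zero_neq_numeral)
  moreover have "w * z ^ (2 ^ j) \<in> int2"
    using z w by simp
  ultimately show False
    using half_notin_int2 by metis
qed

text \<open>The geometric sum turns \<open>1 - c \<zeta>\<close> into \<open>1 + c ^ 2 ^ j\<close>, twice an odd number.\<close>
lemma uniformizer_quotient: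
  fixes c :: int
  assumes "[c = 1] (mod 4)"
  obtains u where "u * (1 - of_int c * \<zeta>) = 1 - \<zeta>" "cong_int2 2 u 1"
proof -
  define S where "S = (\<Sum>i<2 ^ j. (of_int c * \<zeta>) ^ i)"
  have S: "(1 - of_int c * \<zeta>) * S = of_int (1 + c ^ (2 ^ j))"
    using one_diff_power_eq[of "of_int c * \<zeta>" "2 ^ j"] root by (simp add: S_def power_mult_distrib)
  have "[c ^ (2 ^ j) = 1] (mod 4)"
    using cong_pow[OF assms, of "2 ^ j"] by simp
  then obtain t where t: "c ^ (2 ^ j) = 1 + 4 * t"
    by (metis cong_iff_lin cong_sym)
  define w where "w = 1 + 2 * t"
  have w: "1 + c ^ (2 ^ j) = 2 * w" "odd w"
    by (simp_all add: w_def t)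
  have w0: "of_int w \<noteq> (0 :: complex)"
    using w(2) by auto
  have "cong_int2 4 (of_int c) 1"
    using cong_int2_of_int[OF assms] by simp
  then have "cong_int2 4 (of_int c * \<zeta>) (1 * \<zeta>)"
    by (rule cong_int2_mult) auto
  then have "cong_int2 4 S (\<Sum>i<2 ^ j. \<zeta> ^ i)"
    unfolding S_def by (intro cong_int2_sum cong_int2_power) auto
  then have "cong_int2 4 ((1 - \<zeta>) * S) ((1 - \<zeta>) * (\<Sum>i<2 ^ j. \<zeta> ^ i))"
    by (rule cong_int2_lmult) auto
  then obtain z where z: "z \<in> int2" "(1 - \<zeta>) * S = 2 + 4 * z"
    by (auto simp flip: uniformizer_dvd_2 elim: cong_int2E)
  \<comment> \<open>This is \<open>(1 - \<zeta>) * S / (2 * w)\<close>, and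
    \<open>S / (2 * w)\<close> is the inverse of \<open>1 - of_int c * \<zeta>\<close>.\<close>
  define u where "u = (1 + 2 * z) * (1 / of_int w)"
  have "u * (1 - of_int c * \<zeta>) * (2 * of_int w) = ((1 - \<zeta>) * S) * (1 - of_int c * \<zeta>)"
    using w0 unfolding z(2) u_def by (simp add: field_simps)
  also have "\<dots> = (1 - \<zeta>) * ((1 - of_int c * \<zeta>) * S)"
    by (simp only: mult_ac)
  also have "\<dots> = (1 - \<zeta>) * (2 * of_int w)"
    unfolding S w(1) by simp
  finally have "u * (1 - of_int c * \<zeta>) = 1 - \<zeta>"
    using w0 by simp
  moreover have "u = 1 + 2 * ((z - of_int t) * (1 / of_int w))"
    using w0 by (simp add: u_def field_simps) (simp add: w_def)
  then have "cong_int2 2 u 1"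
    by (rule cong_int2I) (use z(1) w(2) in auto)
  ultimately show ?thesis
    using that by blast
qed

end

section \<open>The generating function of the generalized Bernoulli numbers\<close>

text \<open>Integrality is tracked on the exponential coefficients
  \<open>fact k * fps_nth A k\<close>, which multiply by binomial convolution.\<close>

lemma fact_fps_nth_mult:
  fixes A B :: "complex fps"
  shows "fact k * fps_nth (A * B) k =
    (\<Sum>i\<le>k. of_nat (k choose i) * (fact i * fps_nth A i) * (fact (k - i) * fps_nth B (k - i)))"
proof -
  have "fact k * fps_nth (A * B) k = (\<Sum>i\<le>k. fact k * (fps_nth A i * fps_nth B (k - i)))"
    by (simp add: fps_mult_nth atLeast0AtMost sum_distrib_left)
  also have "\<dots> = (\<Sum>i\<le>k. of_nat (k choose i) * (fact i * fps_nth A i) * (fact (k - i) * fps_nth B (k - i)))"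
  proof (rule sum.cong)
    fix i assume "i \<in> {..k}"
    then have "fact k = fact i * fact (k - i) * (k choose i)"
      using binomial_fact_lemma[of i k] by simp
    then have "of_nat (fact k) = (of_nat (fact i * fact (k - i) * (k choose i)) :: complex)"
      by (simp only:)
    then have "fact k = (of_nat (k choose i) * fact i * fact (k - i) :: complex)"
      by (simp add: mult_ac)
    then show "fact k * (fps_nth A i * fps_nth B (k - i)) =
        of_nat (k choose i) * (fact i * fps_nth A i) * (fact (k - i) * fps_nth B (k - i))"
      by simp
  qed simp
  finally show ?thesis .
qed

lemma sum_lessThan_add:
  fixes g :: "nat \<Rightarrow> 'a :: comm_monoid_add"
  shows "sum g {..<n + k} = sum g {..<n} + (\<Sum>i<k. g (n + i))"
  by (induction k) (simp_all add: add.assoc)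

text \<open>Divided by \<open>X\<close>, the generating function of the generalized Bernoulli numbers
  stays a power series because the values of \<open>\<chi>\<close> sum to zero.\<close>
lemma L_neg_generating_function:
  assumes "f > 0" "\<chi> 0 = 0" "\<chi> (int f) = 0" "(\<Sum>a<f. \<chi> (int a)) = 0"
  obtains \<Psi> where "(fps_exp (of_nat f) - 1) * \<Psi> = (\<Sum>a<f. fps_const (\<chi> (int a)) * fps_exp (of_nat a))"
    "\<And>k. L_neg f \<chi> k = - (fact k * fps_nth \<Psi> k)"
proof -
  define E where "E = fps_exp (of_nat f :: complex) - 1"
  define U where "U = fps_shift 1 E"
  define B where "B = gen_bernoulli_fps f \<chi>"
  define N where "N = (\<Sum>a<f. fps_const (\<chi> (int a)) * fps_exp (of_nat a))"
  have E: "E = fps_X * U"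
  proof (rule fps_ext)
    fix n show "fps_nth E n = fps_nth (fps_X * U) n"
      by (cases n) (auto simp: U_def E_def)
  qed
  have U0: "fps_nth U 0 = of_nat f"
    by (simp add: U_def E_def)
  \<comment> \<open>\<open>U\<close> has constant term \<open>f\<close>, hence is a unit, so every
    quotient in \<open>gen_bernoulli_fps\<close> is exact.\<close>
  have "E dvd fps_X * fps_exp (of_nat a)" for a :: nat
    unfolding E using assms(1) U0 by (intro mult_dvd_mono[OF dvd_refl] fps_unit_dvd) auto
  then have "E dvd fps_const c * (fps_X * fps_exp (of_nat a))" for a :: nat and c
    by (simp add: dvd_mult)
  then have "E * (fps_const c * (fps_X * fps_exp (of_nat a)) / E) = fps_const c * (fps_X * fps_exp (of_nat a))"
    for a :: nat and c
    by (rule dvd_mult_div_cancel)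
  then have "E * B = fps_X * (\<Sum>a=1..f. fps_const (\<chi> (int a)) * fps_exp (of_nat a))"
    by (simp add: B_def gen_bernoulli_fps_def sum_distrib_left mult.left_commute flip: E_def)
  then have "U * B = (\<Sum>a=1..f. fps_const (\<chi> (int a)) * fps_exp (of_nat a))"
    unfolding E by (simp add: mult.assoc)
  \<comment> \<open>The ranges differ only in the end points 0 and \<open>f\<close>, where
    \<open>\<chi>\<close> vanishes.\<close>
  also have "\<dots> = N"
    unfolding N_def using assms(2,3)
    by (intro sum.mono_neutral_cong) (auto simp: not_less le_less_Suc_eq Suc_le_eq)
  finally have UB: "U * B = N" .
  have "fps_nth (U * B) 0 = 0"
    using assms(4) unfolding UB N_def by (simp add: fps_sum_nth)
  then have "fps_nth B 0 = 0"
    using U0 assms(1) by simp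
  define \<Psi> where "\<Psi> = fps_shift 1 B"
  have B: "B = fps_X * \<Psi>"
  proof (rule fps_ext)
    fix n show "fps_nth B n = fps_nth (fps_X * \<Psi>) n"
      using \<open>fps_nth B 0 = 0\<close> by (cases n) (auto simp: \<Psi>_def)
  qed
  \<comment> \<open>Dividing the Bernoulli number of index \<open>k + 1\<close> by
    \<open>k + 1\<close> turns its factorial into \<open>fact k\<close>, and the shift lowers the
    index.\<close>
  have "L_neg f \<chi> k = - (fact k * fps_nth \<Psi> k)" for k
    by (simp add: L_neg_def gen_bernoulli_def \<Psi>_def B_def[symmetric] del: of_nat_Suc)
  moreover have "E * \<Psi> = N"
    using UB unfolding E B by (simp add: mult_ac)
  ultimately show ?thesis
    using that unfolding E_def N_def by blast
qed

text \<open>The same \<open>\<Psi>\<close> serves every multiple of the conductor, so the level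
  \<open>2 ^ N\<close> of the measure can be taken as large as needed.\<close>

lemma generating_function_multiple:
  fixes \<Psi> :: "complex fps"
  assumes "(fps_exp (of_nat f) - 1) * \<Psi> = (\<Sum>a<f. fps_const (\<chi> (int a)) * fps_exp (of_nat a))"
    and per: "\<And>a. \<chi> (a + int f) = \<chi> a"
  shows "(fps_exp (of_nat (f * n)) - 1) * \<Psi> = (\<Sum>a<f * n. fps_const (\<chi> (int a)) * fps_exp (of_nat a))"
proof (induction n)
  case (Suc n)
  have per': "\<chi> (int (f * n + a)) = \<chi> (int a)" for a
  proof (induction n)
    case (Suc n)
    then show ?case
      using per[of "int (f * n + a)"] by (simp add: algebra_simps)
  qed simp
  have "(fps_exp (of_nat (f * Suc n)) - 1) * \<Psi> =
      (fps_exp (of_nat (f * n)) - 1) * \<Psi> + fps_exp (of_nat (f * n)) * ((fps_exp (of_nat f) - 1) * \<Psi>)"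
    by (simp add: algebra_simps fps_exp_add_mult)
  also have "\<dots> = (\<Sum>a<f * n. fps_const (\<chi> (int a)) * fps_exp (of_nat a)) +
      (\<Sum>a<f. fps_const (\<chi> (int (f * n + a))) * fps_exp (of_nat (f * n + a)))"
    unfolding Suc assms(1) per' by (simp add: sum_distrib_left fps_exp_add_mult mult_ac)
  also have "\<dots> = (\<Sum>a<f * n + f. fps_const (\<chi> (int a)) * fps_exp (of_nat a))"
    by (rule sum_lessThan_add[symmetric])
  finally show ?case
    by (simp add: add.commute)
qed simp

lemma sum_five_mult_mod:
  fixes g :: "nat \<Rightarrow> 'a :: comm_monoid_add"
  assumes "coprime F 5" "F > 0"
  shows "(\<Sum>b<F. g (5 * b mod F)) = (\<Sum>a<F. g a)"
proof (rule sum.reindex_bij_betw)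
  have "inj_on (\<lambda>b. 5 * b mod F) {..<F}"
  proof (rule inj_onI)
    fix a b assume *: "a \<in> {..<F}" "b \<in> {..<F}" "5 * a mod F = 5 * b mod F"
    then have "[5 * a = 5 * b] (mod F)"
      by (simp add: cong_def)
    then have "[a = b] (mod F)"
      using assms(1) by (simp add: cong_mult_lcancel_nat coprime_commute)
    with * show "a = b"
      by (simp add: cong_def)
  qed
  moreover have "(\<lambda>b. 5 * b mod F) ` {..<F} \<subseteq> {..<F}"
    using assms(2) by auto
  ultimately show "bij_betw (\<lambda>b. 5 * b mod F) {..<F} {..<F}"
    by (simp add: bij_betw_def endo_inj_surj)
qed

text \<open>The right side vanishes at \<open>Y = 1\<close>; the coefficients are those of its
  explicit quotient by \<open>Y - 1\<close>.\<close>

lemma five_term_quotient: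
  fixes Y :: "'a :: comm_ring_1"
  assumes "j < 5"
  shows "(Y - 1) * (\<Sum>i<4. of_int (if i < j then - int (i + 1) else 4 - int i) * Y ^ i) =
    (\<Sum>i<5. Y ^ i) - 5 * Y ^ j"
proof -
  consider "j = 0" | "j = 1" | "j = 2" | "j = 3" | "j = 4"
    using assms by linarith
  then show ?thesis
    by cases (simp_all add: eval_nat_numeral algebra_simps)
qed

text \<open>The value \<open>- 5 * (j - 2)\<close> is the source of the shift by 2 in the measure;
  its factor 5 is later cancelled.\<close>

lemma five_term_quotient_at_1:
  assumes "j < 5"
  shows "(\<Sum>i<4. (if i < j then - int (i + 1) else 4 - int i)) = 10 - 5 * int j"
proof -
  consider "j = 0" | "j = 1" | "j = 2" | "j = 3" | "j = 4"
    using assms by linarith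
  then show ?thesis
    by cases (simp_all add: eval_nat_numeral)
qed

section \<open>Primitive characters of 2-power conductor\<close>

locale two_power_char =
  fixes m :: nat and \<chi> :: "int \<Rightarrow> complex"
  assumes m: "m \<ge> 3" and primitive: "primitive_char (2 ^ m) \<chi>"
begin

lemma chi_period: "\<chi> (a + 2 ^ m) = \<chi> a"
  using primitive by (auto simp: primitive_char_def dirichlet_char_def)

lemma chi_mult: "\<chi> (a * b) = \<chi> a * \<chi> b"
  using primitive by (auto simp: primitive_char_def dirichlet_char_def)

lemma chi_eq_0_iff: "\<chi> a = 0 \<longleftrightarrow> even a"
proof -
  have "\<chi> a \<noteq> 0 \<longleftrightarrow> coprime a (2 ^ m)"
    using primitive by (auto simp: primitive_char_def dirichlet_char_def)
  then show ?thesis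
    using m by simp
qed

lemma chi_1 [simp]: "\<chi> 1 = 1"
  using chi_mult[of 1 1] chi_eq_0_iff[of 1] by simp

lemma chi_power: "\<chi> (a ^ n) = \<chi> a ^ n"
  by (induction n) (simp_all add: chi_mult)

lemma chi_cong:
  assumes "[a = b] (mod 2 ^ m)"
  shows "\<chi> a = \<chi> b"
proof -
  have nat: "\<chi> (c + 2 ^ m * int n) = \<chi> c" for c n
  proof (induction n)
    case (Suc n)
    then show ?case
      using chi_period[of "c + 2 ^ m * int n"] by (simp add: algebra_simps)
  qed simp
  obtain k where k: "b = a + 2 ^ m * k"
    using assms by (metis cong_iff_lin)
  show ?thesis
  proof (cases "k \<ge> 0")
    case True
    then show ?thesis
      using nat[of a "nat k"] k by simp
  next
    case False
    then show ?thesis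
      using nat[of b "nat (- k)"] k by simp
  qed
qed

text \<open>Primitivity yields \<open>a = 1 + h * t\<close> with \<open>\<chi> a\<close> different
  from 1. Then \<open>t\<close> is odd, so \<open>a\<close> is \<open>1 + h\<close> modulo
  \<open>2 ^ m\<close>, whose square is 1 modulo \<open>2 ^ m\<close>; the value must be -1.\<close>

lemma chi_half_conductor: "\<chi> (1 + 2 ^ (m - 1)) = - 1"
proof -
  define h :: int where "h = 2 ^ (m - 1)"
  have h: "2 * h = 2 ^ m" "even h"
    using m unfolding h_def by (simp_all flip: power_Suc)
  have "2 ^ (m - 1) dvd (2 ^ m :: nat)" "2 ^ (m - 1) < (2 ^ m :: nat)"
    using m by (simp_all add: le_imp_power_dvd)
  then have "\<not> (\<forall>a. coprime a (int (2 ^ m)) \<and> [a = 1] (mod int (2 ^ (m - 1))) \<longrightarrow> \<chi> a = 1)"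
    using primitive unfolding primitive_char_def by blast
  then obtain a where a: "[a = 1] (mod h)" "\<chi> a \<noteq> 1"
    by (auto simp: h_def)
  then obtain t where t: "a = 1 + h * t"
    by (metis cong_iff_lin cong_sym)
  have "odd t"
  proof
    assume "even t"
    then obtain s where "t = 2 * s"
      by (elim evenE)
    then have "a = 1 + 2 ^ m * s"
      using t h(1) by (simp add: algebra_simps flip: h(1))
    then have "[a = 1] (mod 2 ^ m)"
      by (metis add_diff_cancel_left' cong_iff_dvd_diff dvd_triv_left)
    from chi_cong[OF this] a(2) show False
      by simp
  qed
  then obtain s where "t = 2 * s + 1"
    by (elim oddE)
  then have "a = 1 + h + 2 ^ m * s"
    using t by (simp add: algebra_simps flip: h(1))
  then have "[a = 1 + h] (mod 2 ^ m)"
    by (metis add_diff_cancel_left' cong_iff_dvd_diff dvd_triv_left)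
  then have "\<chi> (1 + h) \<noteq> 1"
    using chi_cong a(2) by metis
  moreover obtain g where g: "h = 2 * g"
    using h(2) by (elim evenE)
  have "(1 + h)\<^sup>2 = 1 + 2 ^ m * (1 + g)"
    unfolding h(1)[symmetric] using g by (simp add: power2_eq_square algebra_simps)
  then have "[(1 + h)\<^sup>2 = 1] (mod 2 ^ m)"
    by (metis add_diff_cancel_left' cong_iff_dvd_diff dvd_triv_left)
  from chi_cong[OF this] have "\<chi> (1 + h) ^ 2 = 1"
    by (simp only: chi_power chi_1)
  ultimately show ?thesis
    by (auto simp: h_def power2_eq_1_iff)
qed

text \<open>\<open>5 ^ (2 ^ (m - 3))\<close> is \<open>1 + 2 ^ (m - 1)\<close> modulo
  \<open>2 ^ m\<close>, where \<open>\<chi>\<close> takes the value -1.\<close>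

sublocale two_power_root "\<chi> 5" "m - 3"
proof
  have "m - 3 + 2 = m - 1" "m - 3 + 3 = m"
    using m by simp_all
  then have "[5 ^ (2 ^ (m - 3)) = 1 + 2 ^ (m - 1)] (mod (2 :: int) ^ m)"
    using five_power_two_power_cong[of "m - 3"] by (simp only:)
  from chi_cong[OF this] show "\<chi> 5 ^ (2 ^ (m - 3)) = - 1"
    by (simp only: chi_power chi_half_conductor)
qed

lemma chi_odd_is_power:
  assumes "odd a"
  shows "\<exists>i. \<chi> a = \<chi> 5 ^ i"
proof (rule power_of_root_if_root_of_unity[OF root])
  have "Suc (m - 3) \<ge> 1" "Suc (m - 3) + 2 = m"
    using m by simp_all
  then have "[a ^ (2 ^ Suc (m - 3)) = 1] (mod 2 ^ m)"
    using odd_power_two_power_cong_1[OF assms, of "Suc (m - 3)"] by (simp only:)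
  from chi_cong[OF this] show "\<chi> a ^ (2 ^ Suc (m - 3)) = 1"
    by (simp only: chi_power chi_1)
qed

lemma chi_int2 [simp]: "\<chi> a \<in> int2"
  using chi_odd_is_power[of a] chi_eq_0_iff[of a] by (cases "even a") auto

text \<open>All nonzero values are powers of \<open>\<chi> 5\<close>, so modulo
  \<open>1 - \<chi> 5\<close> character sums reduce to counting odd numbers.\<close>

lemma chi_cong_1:
  assumes "odd a"
  shows "cong_int2 (1 - \<chi> 5) (\<chi> a) 1"
proof -
  obtain i where i: "\<chi> a = \<chi> 5 ^ i"
    using chi_odd_is_power[OF assms] by blast
  have "cong_int2 (1 - \<chi> 5) (\<chi> 5) 1"
    by (rule cong_int2I[of _ _ _ "- 1"]) auto
  then show ?thesis
    unfolding i using cong_int2_power[of "1 - \<chi> 5" "\<chi> 5" 1 i] by simp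
qed

lemma chi_minus_1: "\<chi> (- 1) = 1 \<or> \<chi> (- 1) = - 1"
  using chi_mult[of "- 1" "- 1"] by (simp add: square_eq_1_iff)

lemma cnj_chi_5: "cnj (\<chi> 5) = 1 / \<chi> 5"
proof -
  have "cmod (\<chi> 5) ^ (2 ^ (m - 3)) = 1"
    using arg_cong[OF root, of cmod] by (simp add: norm_power)
  then have "cmod (\<chi> 5) = 1"
    using power_eq_imp_eq_base[of "cmod (\<chi> 5)" "2 ^ (m - 3)" 1] by simp
  then have "\<chi> 5 * cnj (\<chi> 5) = 1"
    using complex_norm_square[of "\<chi> 5"] by simp
  then show ?thesis
    by (cases "\<chi> 5 = 0") (simp_all add: eq_divide_eq mult.commute)
qed

lemma chi_five_mult_mod:
  assumes "N \<ge> m"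
  shows "\<chi> (int (5 * b mod 2 ^ N)) = \<chi> (5 * int b)"
proof (rule chi_cong)
  have "[int (5 * b mod 2 ^ N) = 5 * int b] (mod 2 ^ N)"
    by (simp add: zmod_int cong_def)
  moreover have "(2 :: int) ^ m dvd 2 ^ N"
    using assms by (simp add: le_imp_power_dvd)
  ultimately show "[int (5 * b mod 2 ^ N) = 5 * int b] (mod 2 ^ m)"
    by (rule cong_dvd_modulus)
qed

text \<open>Substituting \<open>5 * b\<close> for \<open>a\<close> multiplies the sum by
  \<open>\<chi> 5\<close>, which is not 1.\<close>

lemma sum_chi: "(\<Sum>a<2 ^ m. \<chi> (int a)) = 0"
proof -
  have "(\<Sum>a<2 ^ m. \<chi> (int a)) = (\<Sum>b<2 ^ m. \<chi> (int (5 * b mod 2 ^ m)))"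
    by (rule sum_five_mult_mod[symmetric]) auto
  also have "\<dots> = \<chi> 5 * (\<Sum>a<2 ^ m. \<chi> (int a))"
    by (simp only: chi_five_mult_mod[OF order_refl] chi_mult sum_distrib_left)
  finally have "(1 - \<chi> 5) * (\<Sum>a<2 ^ m. \<chi> (int a)) = 0"
    by (simp add: algebra_simps)
  then show ?thesis
    using uniformizer_nonzero by simp
qed

end

section \<open>The 2-adic measure\<close>

text \<open>In exponential coefficients \<open>S\<close> is the constant 5 modulo \<open>F\<close>,
  so in the convolution for \<open>S * A\<close> only the term with \<open>i = 0\<close> survives,
  once the lower coefficients of \<open>A\<close> are integral. They are, by strong induction, since
  5 is invertible in \<open>int2\<close>.\<close>

lemma int2_fps_quotient:
  fixes S A :: "complex fps" and F :: complex
  assumes F: "F \<in> int2"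
    and S0: "fps_nth S 0 = 5" and S: "\<And>i. i > 0 \<Longrightarrow> cong_int2 F (fact i * fps_nth S i) 0"
    and SA: "\<And>k. fact k * fps_nth (S * A) k \<in> int2"
  shows "cong_int2 F (fact k * fps_nth (S * A) k) (5 * (fact k * fps_nth A k))"
proof -
  have step: "cong_int2 F (fact k * fps_nth (S * A) k) (5 * (fact k * fps_nth A k))"
    if "\<And>i. i < k \<Longrightarrow> fact i * fps_nth A i \<in> int2" for k
  proof -
    let ?t = "\<lambda>i. of_nat (k choose i) * (fact i * fps_nth S i) * (fact (k - i) * fps_nth A (k - i))"
    have "cong_int2 F (\<Sum>i\<le>k. ?t i) (\<Sum>i\<le>k. if i = 0 then 5 * (fact k * fps_nth A k) else 0)"
    proof (rule cong_int2_sum)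
      fix i assume i: "i \<in> {..k}"
      show "cong_int2 F (?t i) (if i = 0 then 5 * (fact k * fps_nth A k) else 0)"
      proof (cases "i = 0")
        case False
        then have "of_nat (k choose i) * (fact (k - i) * fps_nth A (k - i)) \<in> int2"
          using i by (intro int2_mult[OF int2_of_nat] that) auto
        from cong_int2_lmult[OF S this] False show ?thesis
          by (simp add: mult_ac)
      qed (simp add: S0)
    qed
    then show ?thesis
      by (simp add: fact_fps_nth_mult)
  qed
  have int: "fact k * fps_nth A k \<in> int2" for k
  proof (induction k rule: less_induct)
    case (less k)
    then have "cong_int2 F (5 * (fact k * fps_nth A k)) (fact k * fps_nth (S * A) k)"
      by (intro cong_int2_sym[OF step])
    then have "5 * (fact k * fps_nth A k) \<in> int2"
      using F SA by (rule cong_int2_in)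
    then show ?case
      using int2_divide_odd[of "5 * (fact k * fps_nth A k)" 5] by simp
  qed
  show "cong_int2 F (fact k * fps_nth (S * A) k) (5 * (fact k * fps_nth A k))"
    by (rule step) (rule int)
qed

context two_power_char
begin

definition G :: "nat \<Rightarrow> complex" where
  "G k = (1 - 5 ^ (k + 1) * \<chi> 5) * L_neg (2 ^ m) \<chi> k"

text \<open>For \<open>b < 2 ^ N\<close> the quotient lies between 0 and 4; subtracting 2 centres
  it, so that the mass changes sign under \<open>b \<mapsto> 2 ^ N - b\<close> for odd
  \<open>b\<close>.\<close>

definition mu :: "nat \<Rightarrow> nat \<Rightarrow> int" where
  "mu N b = int (5 * b div 2 ^ N) - 2"

text \<open>\<open>G k\<close> is the integral of \<open>\<chi>(x) x ^ k\<close> against a bounded 2-adic measure,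
  and \<^const>\<open>mu\<close> is the mass which the measure gives to the class of \<open>5 * b\<close> modulo \<open>2 ^ N\<close>.\<close>
lemma G_cong_sum:
  assumes N: "N \<ge> m"
  shows "cong_int2 (2 ^ N) (G k) (\<Sum>b<2 ^ N. \<chi> (5 * int b) * of_int ((5 * int b) ^ k * mu N b))"
proof -
  define F :: nat where "F = 2 ^ N"
  obtain \<Psi> where \<Psi>: "(fps_exp (of_nat (2 ^ m)) - 1) * \<Psi> =
        (\<Sum>a<2 ^ m. fps_const (\<chi> (int a)) * fps_exp (of_nat a))"
      and L: "\<And>k. L_neg (2 ^ m) \<chi> k = - (fact k * fps_nth \<Psi> k)"
  proof (rule L_neg_generating_function[of "2 ^ m" \<chi>])
    show "\<chi> 0 = 0" "\<chi> (int (2 ^ m)) = 0"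
      using m by (simp_all add: chi_eq_0_iff)
  qed (use sum_chi in auto)
  have F: "F = 2 ^ m * 2 ^ (N - m)" "F > 0"
    using N by (simp_all add: F_def flip: power_add)
  have \<Psi>F: "(fps_exp (of_nat F) - 1) * \<Psi> = (\<Sum>a<F. fps_const (\<chi> (int a)) * fps_exp (of_nat a))"
    unfolding F(1) by (rule generating_function_multiple[OF \<Psi>]) (simp add: chi_period)
  \<comment> \<open>Replacing \<open>X\<close> by \<open>5 * X\<close> multiplies the coefficient of
    index \<open>k\<close> by \<open>5 ^ k\<close>; thus \<open>A\<close> below has the exponential
    coefficients \<open>- G k\<close>.\<close>
  define \<Psi>5 where "\<Psi>5 = \<Psi> oo (fps_const 5 * fps_X)"
  have "((fps_exp (of_nat F) - 1) * \<Psi>) oo (fps_const 5 * fps_X) =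
      (\<Sum>a<F. fps_const (\<chi> (int a)) * fps_exp (of_nat a)) oo (fps_const 5 * fps_X)"
    by (simp only: \<Psi>F)
  then have \<Psi>5: "(fps_exp (5 * of_nat F) - 1) * \<Psi>5 = (\<Sum>a<F. fps_const (\<chi> (int a)) * fps_exp (5 * of_nat a))"
    by (simp add: fps_compose_mult_distrib fps_compose_sum_distrib fps_compose_sub_distrib \<Psi>5_def)
  define Y where "Y = fps_exp (of_nat F :: complex)"
  define S where "S = (\<Sum>i<5. Y ^ i)"
  define A where "A = \<Psi> - fps_const (5 * \<chi> 5) * \<Psi>5"
  define q where "q b i = (if i < 5 * b div F then - int (i + 1) else 4 - int i)" for b i
  define T where "T = (\<Sum>b<F. fps_const (\<chi> (5 * int b)) * fps_exp (of_nat (5 * b mod F)) *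
      (\<Sum>i<4. of_int (q b i) * Y ^ i))"
  have Ypow: "Y ^ i = fps_exp (of_nat (i * F))" for i
    by (simp add: Y_def fps_exp_power_mult)
  have j: "5 * b div F < 5" if "b < F" for b
    using that by (simp add: div_less_iff_less_mult F(2))
  have Y5: "fps_exp (5 * of_nat F) - 1 = (Y - 1) * S"
    using power_diff_1_eq[of Y 5] by (simp add: Ypow S_def)
  have split: "fps_exp (5 * of_nat b) = fps_exp (of_nat (5 * b mod F)) * Y ^ (5 * b div F)" for b
  proof -
    have "(5 * of_nat b :: complex) = of_nat (5 * b mod F + 5 * b div F * F)"
      by (simp only: mod_div_mult_eq) simp
    then show ?thesis
      by (simp only: Ypow of_nat_add fps_exp_add_mult)
  qed
  \<comment> \<open>Multiplying by \<open>(Y - 1) * S\<close>, which is \<open>Y ^ 5 - 1\<close>,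
    clears both denominators at once. Reindexing the first sum by \<open>5 * b mod F\<close> then
    matches the two sums term by term.\<close>
  have "(Y - 1) * (S * A) = S * ((Y - 1) * \<Psi>) - fps_const (5 * \<chi> 5) * ((fps_exp (5 * of_nat F) - 1) * \<Psi>5)"
    unfolding A_def Y5 by (simp add: algebra_simps)
  also have "(Y - 1) * \<Psi> = (\<Sum>b<F. fps_const (\<chi> (5 * int b)) * fps_exp (of_nat (5 * b mod F)))"
  proof -
    have "(Y - 1) * \<Psi> = (\<Sum>b<F. fps_const (\<chi> (int (5 * b mod F))) * fps_exp (of_nat (5 * b mod F)))"
      unfolding Y_def \<Psi>F
      by (rule sum_five_mult_mod[symmetric]) (auto simp: F_def)
    then show ?thesis
      using chi_five_mult_mod[OF N] by (simp only: F_def)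
  qed
  also have "(fps_exp (5 * of_nat F) - 1) * \<Psi>5 =
      (\<Sum>b<F. fps_const (\<chi> (int b)) * (fps_exp (of_nat (5 * b mod F)) * Y ^ (5 * b div F)))"
    unfolding \<Psi>5 by (simp only: split)
  also have "S * (\<Sum>b<F. fps_const (\<chi> (5 * int b)) * fps_exp (of_nat (5 * b mod F))) -
      fps_const (5 * \<chi> 5) * (\<Sum>b<F. fps_const (\<chi> (int b)) * (fps_exp (of_nat (5 * b mod F)) * Y ^ (5 * b div F)))
    = (\<Sum>b<F. fps_const (\<chi> (5 * int b)) * fps_exp (of_nat (5 * b mod F)) * (S - 5 * Y ^ (5 * b div F)))"
    unfolding sum_distrib_left sum_subtractf[symmetric]
  proof (rule sum.cong)
    fix b
    have "fps_const (5 * \<chi> 5) * fps_const (\<chi> (int b)) = fps_const (\<chi> (5 * int b)) * 5"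
      by (simp add: chi_mult fps_numeral_fps_const mult_ac)
    then have h: "fps_const (5 * \<chi> 5) * (fps_const (\<chi> (int b)) * x) = fps_const (\<chi> (5 * int b)) * 5 * x" for x
      by (simp add: mult.assoc[symmetric])
    show "S * (fps_const (\<chi> (5 * int b)) * fps_exp (of_nat (5 * b mod F))) -
        fps_const (5 * \<chi> 5) * (fps_const (\<chi> (int b)) * (fps_exp (of_nat (5 * b mod F)) * Y ^ (5 * b div F)))
      = fps_const (\<chi> (5 * int b)) * fps_exp (of_nat (5 * b mod F)) * (S - 5 * Y ^ (5 * b div F))"
      unfolding h by (simp only: right_diff_distrib mult_ac)
  qed simp
  also have "\<dots> = (Y - 1) * T"
    unfolding T_def sum_distrib_left[of "Y - 1"]
  proof (rule sum.cong)
    fix b assume "b \<in> {..<F}"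
    then have h: "(Y - 1) * (\<Sum>i<4. of_int (q b i) * Y ^ i) = S - 5 * Y ^ (5 * b div F)"
      unfolding q_def S_def by (intro five_term_quotient j) auto
    show "fps_const (\<chi> (5 * int b)) * fps_exp (of_nat (5 * b mod F)) * (S - 5 * Y ^ (5 * b div F)) =
        (Y - 1) * (fps_const (\<chi> (5 * int b)) * fps_exp (of_nat (5 * b mod F)) * (\<Sum>i<4. of_int (q b i) * Y ^ i))"
      unfolding h[symmetric] by (simp only: mult_ac)
  qed simp
  finally have "(Y - 1) * (S * A) = (Y - 1) * T" .
  moreover have "Y - 1 \<noteq> 0"
    using F(2) by (simp add: Y_def)
  ultimately have SA: "S * A = T"
    by simp
  have T_nth: "fact k * fps_nth T k =
      (\<Sum>b<F. \<chi> (5 * int b) * of_int (\<Sum>i<4. q b i * (int (5 * b mod F) + int i * int F) ^ k))" for k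
  proof -
    have "fps_const (\<chi> (5 * int b)) * fps_exp (of_nat (5 * b mod F)) * (of_int (q b i) * Y ^ i) =
        fps_const (\<chi> (5 * int b) * of_int (q b i)) * fps_exp (of_nat (5 * b mod F + i * F))" for b i
      by (simp add: Ypow fps_exp_add_mult mult_ac flip: fps_of_int fps_const_mult)
    then have "T = (\<Sum>b<F. \<Sum>i<4. fps_const (\<chi> (5 * int b) * of_int (q b i)) *
        fps_exp (of_nat (5 * b mod F + i * F)))"
      unfolding T_def sum_distrib_left by simp
    then show ?thesis
      by (simp add: fps_sum_nth sum_distrib_left mult_ac)
  qed
  have "fps_nth \<Psi>5 k = 5 ^ k * fps_nth \<Psi> k" for k
    by (simp add: \<Psi>5_def)
  then have A_nth: "fact k * fps_nth A k = - G k" for k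
    by (simp add: A_def G_def L algebra_simps)
  have S0: "fps_nth S 0 = 5"
    by (simp add: S_def Ypow fps_sum_nth)
  have S: "cong_int2 (of_nat F) (fact i * fps_nth S i) 0" if i: "i > 0" for i
  proof -
    obtain i' where i': "i = Suc i'"
      using i gr0_implies_Suc by blast
    have "(\<Sum>l<5. (l * F) ^ i) = F * (\<Sum>l<5. l * (l * F) ^ i')"
      unfolding i' sum_distrib_left by (intro sum.cong) (simp_all only: power_Suc mult_ac)
    moreover have "fact i * fps_nth S i = of_nat (\<Sum>l<5. (l * F) ^ i)"
      unfolding S_def Ypow fps_sum_nth sum_distrib_left of_nat_sum by (intro sum.cong) simp_all
    ultimately have "fact i * fps_nth S i = 0 + of_nat F * of_nat (\<Sum>l<5. l * (l * F) ^ i')"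
      by (simp only: of_nat_mult add_0)
    then show ?thesis
      by (rule cong_int2I) (rule int2_of_nat)
  qed
  have "fact k * fps_nth (S * A) k \<in> int2" for k
    unfolding SA T_nth by (intro int2_sum int2_mult chi_int2 int2_of_int)
  from int2_fps_quotient[OF int2_of_nat S0 S this, of k]
  have quot: "cong_int2 (of_nat F) (fact k * fps_nth T k) (- (5 * G k))"
    unfolding SA A_nth by simp
  have "cong_int2 (of_nat F) (fact k * fps_nth T k)
      (\<Sum>b<F. \<chi> (5 * int b) * of_int ((5 * int b) ^ k * (- 5 * mu N b)))"
    unfolding T_nth
  proof (intro cong_int2_sum cong_int2_lmult chi_int2)
    fix b assume "b \<in> {..<F}"
    then have q_sum: "(\<Sum>i<4. q b i) = - 5 * mu N b"
      unfolding q_def using five_term_quotient_at_1[OF j, of b] by (simp add: mu_def F_def)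
    \<comment> \<open>Modulo \<open>F\<close> the base no longer depends on \<open>i\<close>, so
      only the total weight, the quotient at \<open>Y = 1\<close>, remains.\<close>
    have "[(\<Sum>i<4. q b i * (int (5 * b mod F) + int i * int F) ^ k) =
        (\<Sum>i<4. q b i * (5 * int b) ^ k)] (mod int F)"
      by (intro cong_sum cong_mult cong_pow cong_refl) (simp add: cong_def zmod_int)
    also have "(\<Sum>i<4. q b i * (5 * int b) ^ k) = (5 * int b) ^ k * (- 5 * mu N b)"
      unfolding sum_distrib_right[symmetric] q_sum by (rule mult.commute)
    finally show "cong_int2 (of_nat F) (of_int (\<Sum>i<4. q b i * (int (5 * b mod F) + int i * int F) ^ k))
        (of_int ((5 * int b) ^ k * (- 5 * mu N b)))"
      by (rule cong_int2_of_int[of _ _ "int F", unfolded of_int_of_nat_eq])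
  qed
  with quot have "cong_int2 (of_nat F) (- (5 * G k))
      (\<Sum>b<F. \<chi> (5 * int b) * of_int ((5 * int b) ^ k * (- 5 * mu N b)))"
    by (rule cong_int2_trans[OF cong_int2_sym])
  then have "cong_int2 (of_nat F) (- 1 / of_int 5 * (- (5 * G k)))
      (- 1 / of_int 5 * (\<Sum>b<F. \<chi> (5 * int b) * of_int ((5 * int b) ^ k * (- 5 * mu N b))))"
    by (rule cong_int2_lmult) (rule int2_divide_odd, simp_all)
  also have "- 1 / of_int 5 * (\<Sum>b<F. \<chi> (5 * int b) * of_int ((5 * int b) ^ k * (- 5 * mu N b))) =
      (\<Sum>b<F. \<chi> (5 * int b) * of_int ((5 * int b) ^ k * mu N b))"
    unfolding sum_distrib_left by (intro sum.cong) simp_all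
  finally show ?thesis
    by (simp add: F_def)
qed

end

text \<open>With \<open>w = 4 * v + 3\<close> the power is \<open>5 * w + 1\<close>; this residue of
  \<open>w\<close> modulo 4 makes the number of odd \<open>b\<close> with
  \<open>w < b \<le> 2 * w\<close> odd.\<close>

lemma sixteen_power_form: "m > 0 \<Longrightarrow> \<exists>v. (16::nat) ^ m = 5 * (4 * v + 3) + 1"
proof (induction m rule: nat_induct_non_zero)
  case (Suc m)
  then obtain v where "(16::nat) ^ m = 5 * (4 * v + 3) + 1"
    by blast
  then have "(16::nat) ^ Suc m = 5 * (4 * (16 * v + 12) + 3) + 1"
    by simp
  then show ?case
    by blast
qed (auto intro: exI[of _ 0])

section \<open>Halving the measure by the symmetry under negation\<close>

context two_power_char
begin

text \<open>One representative from each pair \<open>b\<close>, \<open>2 ^ N - b\<close>.\<close>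

definition half_sum :: "nat \<Rightarrow> nat \<Rightarrow> complex" where
  "half_sum N k = (\<Sum>b<2 ^ (N - 1). \<chi> (5 * int b) * of_int ((5 * int b) ^ k * mu N b))"

text \<open>The remainder \<open>r\<close> is odd, hence nonzero, so reflection turns it into
  \<open>2 ^ N - r\<close> and the quotient into 4 minus the quotient.\<close>

lemma mu_reflect:
  assumes "N \<ge> 1" "odd b" "b < 2 ^ N"
  shows "mu N (2 ^ N - b) = - mu N b"
proof -
  define r where "r = 5 * b mod 2 ^ N"
  have "even (2 ^ N :: nat)"
    using assms(1) by simp
  then have "odd r"
    unfolding r_def using assms(2) by (simp add: dvd_mod_iff)
  then have r: "0 < r" "r < 2 ^ N"
    by (auto simp: r_def odd_pos)
  have "int r < int (2 ^ N)"
    using r(2) by (simp only: of_nat_less_iff)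
  then have r': "int r < 2 ^ N"
    by simp
  have "int (5 * b) = int (2 ^ N * (5 * b div 2 ^ N) + r)"
    unfolding r_def by (simp only: mult_div_mod_eq)
  then have eq: "5 * int b = 2 ^ N * int (5 * b div 2 ^ N) + int r"
    by (simp only: of_nat_mult of_nat_add of_nat_power of_nat_numeral)
  have "int (5 * (2 ^ N - b)) = 2 ^ N * (4 - int (5 * b div 2 ^ N)) + (2 ^ N - int r)"
    using assms(3) eq by (simp add: of_nat_diff algebra_simps)
  then have "int (5 * (2 ^ N - b)) div 2 ^ N = 4 - int (5 * b div 2 ^ N)"
    by (rule int_div_pos_eq) (use r' r(1) in linarith)+
  then show ?thesis
    by (simp add: mu_def zdiv_int)
qed

text \<open>The parity condition makes the measure in \<open>G_cong_sum\<close> invariant under \<open>x \<mapsto> - x\<close>,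
  which yields a factor 2 beyond the integrality of \<open>G k\<close>.\<close>
lemma half_G_cong:
  assumes "N \<ge> m" and parity: "\<chi> (- 1) \<noteq> (- 1) ^ k"
  shows "cong_int2 (2 ^ (N - 1)) (G k / 2) (half_sum N k)"
proof -
  define h :: nat where "h = 2 ^ (N - 1)"
  define g where "g b = \<chi> (5 * int b) * of_int ((5 * int b) ^ k * mu N b)" for b
  have N: "2 ^ N = 2 * h" "even h"
    using assms m by (simp_all add: h_def flip: power_Suc)
  have g_even: "g b = 0" if "even b" for b
    using that by (simp add: g_def chi_eq_0_iff)
  \<comment> \<open>With this, the signs coming from \<open>\<chi>\<close>, from the power
    \<open>k\<close> and from \<open>mu\<close> multiply to 1.\<close>
  have chi: "\<chi> (- 1) = - ((- 1) ^ k)"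
    using parity chi_minus_1 by (cases "even k") auto
  have reflect: "cong_int2 (2 * of_nat h) (g (2 * h - b)) (g b)" if b: "0 < b" "b < h" for b
  proof (cases "even b")
    case False
    define c where "c = 5 * int b"
    have c: "5 * int (2 * h - b) = - c + 2 * int h * 5"
      using b by (simp add: c_def of_nat_diff)
    have "[- c + 2 * int h * 5 = - c] (mod 2 * int h)"
      by (simp add: cong_iff_dvd_diff)
    moreover have "(2 :: int) ^ m dvd 2 * int h"
      using le_imp_power_dvd[OF assms(1), of "2 :: int"] N(1)
      by (metis of_nat_mult of_nat_numeral of_nat_power)
    ultimately have "[- c + 2 * int h * 5 = - c] (mod 2 ^ m)"
      by (rule cong_dvd_modulus)
    then have "\<chi> (5 * int (2 * h - b)) = \<chi> (- 1) * \<chi> c"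
      unfolding c using chi_cong chi_mult[of "- 1" c] by simp
    moreover have "mu N (2 * h - b) = - mu N b"
      using mu_reflect[of N b] N False b assms(1) m by simp
    moreover have "[(- c + 2 * int h * 5) ^ k * (- mu N b) = (- c) ^ k * (- mu N b)] (mod 2 * int h)"
      by (intro cong_mult cong_pow cong_refl) (simp add: cong_iff_dvd_diff)
    then have "cong_int2 (of_int (2 * int h)) (of_int ((- c + 2 * int h * 5) ^ k * (- mu N b)))
        (of_int ((- c) ^ k * (- mu N b)))"
      by (rule cong_int2_of_int)
    then have "cong_int2 (of_int (2 * int h)) (\<chi> (- 1) * \<chi> c * of_int ((- c + 2 * int h * 5) ^ k * (- mu N b)))
        (\<chi> (- 1) * \<chi> c * of_int ((- c) ^ k * (- mu N b)))"
      by (rule cong_int2_lmult) simp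
    moreover have "\<chi> (- 1) * \<chi> c * of_int ((- c) ^ k * (- mu N b)) = g b"
      unfolding chi g_def c_def[symmetric] by (cases "even k") simp_all
    ultimately show ?thesis
      by (simp only: g_def c of_int_mult of_int_numeral of_int_of_nat_eq)
  qed (simp add: g_even)
  have "(\<Sum>b<2 * h. g b) = (\<Sum>b<h. g b) + (\<Sum>i<h. g (h + i))"
    using sum_lessThan_add[of g h h] by (simp only: mult_2)
  \<comment> \<open>The midpoint \<open>h\<close> is its own mirror image, but it is even and
    contributes 0.\<close>
  also have "(\<Sum>i<h. g (h + i)) = (\<Sum>i\<in>{1..<h}. g (h + i))"
    using g_even[OF N(2)] by (intro sum.mono_neutral_right) (auto simp: not_le)
  also have "\<dots> = (\<Sum>b\<in>{1..<h}. g (2 * h - b))"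
    by (rule sum.reindex_bij_witness[of _ "\<lambda>b. h - b" "\<lambda>b. h - b"]) (auto simp: mult_2)
  finally have split: "(\<Sum>b<2 * h. g b) = (\<Sum>b<h. g b) + (\<Sum>b\<in>{1..<h}. g (2 * h - b))" .
  have "cong_int2 (2 * of_nat h) (\<Sum>b\<in>{1..<h}. g (2 * h - b)) (\<Sum>b\<in>{1..<h}. g b)"
    by (intro cong_int2_sum reflect) auto
  also have "(\<Sum>b\<in>{1..<h}. g b) = (\<Sum>b<h. g b)"
    using g_even[of 0] by (intro sum.mono_neutral_left) (auto simp: not_le)
  finally have "cong_int2 (2 * of_nat h) (\<Sum>b<2 * h. g b) ((\<Sum>b<h. g b) + (\<Sum>b<h. g b))"
    unfolding split by (intro cong_int2_add cong_int2_refl)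
  moreover have "cong_int2 (2 * of_nat h) (G k) (\<Sum>b<2 * h. g b)"
  proof -
    have "(2 :: complex) ^ N = 2 * of_nat h"
      using arg_cong[OF N(1), of "of_nat :: nat \<Rightarrow> complex"] by simp
    then show ?thesis
      using G_cong_sum[OF assms(1), of k] by (simp only: N(1) g_def)
  qed
  ultimately have "cong_int2 (2 * of_nat h) (G k) ((\<Sum>b<h. g b) + (\<Sum>b<h. g b))"
    using cong_int2_trans by blast
  then have "cong_int2 (1 / 2 * (2 * of_nat h)) (1 / 2 * G k) (1 / 2 * ((\<Sum>b<h. g b) + (\<Sum>b<h. g b)))"
    by (rule cong_int2_scale)
  then show ?thesis
    by (simp add: half_sum_def g_def h_def mult_2[symmetric] del: sum.lessThan_Suc)
qed

lemma half_sum_int2: "half_sum N k \<in> int2"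
  unfolding half_sum_def by (intro int2_sum int2_mult chi_int2 int2_of_int)

lemma half_G_int2:
  assumes "\<chi> (- 1) \<noteq> (- 1) ^ k"
  shows "G k / 2 \<in> int2"
  using half_G_cong[OF order_refl assms] by (rule cong_int2_in) (simp_all add: half_sum_int2)

text \<open>In the half sum only odd \<open>b\<close> contribute, and
  \<open>(5 * b) ^ (2 ^ n * q)\<close> is 1 modulo \<open>2 ^ (n + 2)\<close>. The level
  \<open>N\<close> is chosen so that \<open>2 ^ (N - 1)\<close> is a multiple of that
  modulus.\<close>

lemma half_G_cong_shift:
  assumes parity: "\<chi> (- 1) \<noteq> (- 1) ^ k" and "n \<ge> 1"
  shows "cong_int2 (2 ^ (n + 2)) (G (k + 2 ^ n * q) / 2) (G k / 2)"
proof -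
  define N where "N = m + n + 3"
  have G: "cong_int2 (2 ^ (n + 2)) (G l / 2) (half_sum N l)" if "\<chi> (- 1) \<noteq> (- 1) ^ l" for l
  proof (rule cong_int2_weaken)
    have "N \<ge> m" "N - 1 = n + 2 + m"
      by (simp_all add: N_def)
    then show "cong_int2 (2 ^ (n + 2) * 2 ^ m) (G l / 2) (half_sum N l)"
      using half_G_cong[OF _ that, of N] by (simp only: power_add)
  qed auto
  have "even (2 ^ n * q)"
    using assms(2) by simp
  then have parity': "\<chi> (- 1) \<noteq> (- 1) ^ (k + 2 ^ n * q)"
    using parity by (simp only: power_add) simp
  have "cong_int2 (2 ^ (n + 2)) (half_sum N (k + 2 ^ n * q)) (half_sum N k)"
    unfolding half_sum_def
  proof (rule cong_int2_sum)
    fix b :: nat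
    define c where "c = 5 * int b"
    show "cong_int2 (2 ^ (n + 2)) (\<chi> (5 * int b) * of_int ((5 * int b) ^ (k + 2 ^ n * q) * mu N b))
        (\<chi> (5 * int b) * of_int ((5 * int b) ^ k * mu N b))"
    proof (cases "even b")
      case True
      then have "\<chi> (5 * int b) = 0"
        by (simp add: chi_eq_0_iff)
      then show ?thesis
        by simp
    next
      case False
      then have "[(c ^ q) ^ (2 ^ n) = 1] (mod 2 ^ (n + 2))"
        using assms(2) by (intro odd_power_two_power_cong_1) (simp_all add: c_def)
      then have "[c ^ k * (c ^ q) ^ (2 ^ n) * mu N b = c ^ k * 1 * mu N b] (mod 2 ^ (n + 2))"
        by (intro cong_mult cong_refl)
      then have "[c ^ (k + 2 ^ n * q) * mu N b = c ^ k * mu N b] (mod 2 ^ (n + 2))"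
        by (simp only: power_add mult.commute[of "2 ^ n" q] power_mult mult_1_right)
      from cong_int2_of_int[OF this] show ?thesis
        unfolding c_def[symmetric] by (intro cong_int2_lmult chi_int2) simp
    qed
  qed
  then show ?thesis
    using G[OF parity] G[OF parity'] cong_int2_sym cong_int2_trans by blast
qed

lemma half_G_cong_1:
  assumes "\<chi> (- 1) \<noteq> (- 1) ^ k"
  shows "cong_int2 (1 - \<chi> 5) (G k / 2) 1"
proof -
  obtain v where v: "(16::nat) ^ m = 5 * (4 * v + 3) + 1"
    using sixteen_power_form m by fastforce
  define w where "w = 4 * v + 3"
  \<comment> \<open>This level makes \<open>2 ^ N\<close> the power of 16 decomposed above.\<close>
  define N where "N = 4 * m"
  define h :: nat where "h = 2 ^ (N - 1)"
  have "2 ^ N = (16::nat) ^ m"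
    by (simp add: N_def power_mult)
  moreover have "2 ^ N = 2 * h"
    using m by (simp add: h_def N_def flip: power_Suc)
  ultimately have F: "2 ^ N = 5 * w + 1" "2 ^ N = 2 * h"
    using v by (simp_all add: w_def)
  have N: "N \<ge> m" "N - 1 = Suc (N - 2)"
    using m by (simp_all add: N_def)
  define B where "B = {b. odd b \<and> w < b \<and> b \<le> 2 * w}"
  have summand: "cong_int2 (1 - \<chi> 5) (\<chi> (5 * int b) * of_int ((5 * int b) ^ k * mu N b))
      (if b \<in> B then 1 else 0)" if b: "b < h" for b
  proof (cases "even b")
    case True
    then have "\<chi> (5 * int b) = 0"
      by (simp add: chi_eq_0_iff)
    with True show ?thesis
      by (simp add: B_def)
  next
    case False
    \<comment> \<open>As \<open>2 ^ N = 5 * w + 1\<close>, the quotient jumps just after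
      \<open>w\<close> and just after \<open>2 * w\<close>, and it stays below 3 for
      \<open>b < h\<close>. Only the value 1 makes \<open>mu\<close> odd.\<close>
    have div: "5 * b div 2 ^ N = (if b \<le> w then 0 else if b \<le> 2 * w then 1 else 2)"
      using b F by (auto intro!: div_nat_eqI)
    then have "odd (mu N b) \<longleftrightarrow> b \<in> B"
      using False by (auto simp: mu_def B_def)
    moreover have "odd ((5 * int b) ^ k)"
      using False by simp
    ultimately have "odd ((5 * int b) ^ k * mu N b) \<longleftrightarrow> b \<in> B"
      by simp
    then have "[(5 * int b) ^ k * mu N b = (if b \<in> B then 1 else 0)] (mod 2)"
      by (auto simp: cong_def mod2_eq_if)
    from cong_int2_of_int[OF this]
    have "cong_int2 (1 - \<chi> 5) (of_int ((5 * int b) ^ k * mu N b)) (of_int (if b \<in> B then 1 else 0))"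
      by (intro cong_int2_uniformizer_if_2) (simp only: of_int_numeral)
    then have "cong_int2 (1 - \<chi> 5) (\<chi> (5 * int b) * of_int ((5 * int b) ^ k * mu N b))
        (1 * of_int (if b \<in> B then 1 else 0))"
      using False by (intro cong_int2_mult chi_cong_1 chi_int2 int2_of_int) simp_all
    then show ?thesis
      by (cases "b \<in> B") simp_all
  qed
  have "B = (\<lambda>i. 4 * v + 5 + 2 * i) ` {..<2 * v + 1}"
  proof (intro equalityI subsetI)
    fix b assume "b \<in> B"
    then have b: "odd b" "4 * v + 3 < b" "b \<le> 8 * v + 6"
      by (simp_all add: B_def w_def)
    then obtain c where c: "b = 2 * c + 1"
      by (elim oddE)
    then show "b \<in> (\<lambda>i. 4 * v + 5 + 2 * i) ` {..<2 * v + 1}"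
      using b by (intro image_eqI[of _ _ "c - (2 * v + 2)"]) auto
  qed (auto simp: B_def w_def)
  then have card_B: "card B = 2 * v + 1"
    by (simp add: card_image inj_on_def)
  have "cong_int2 (1 - \<chi> 5) (half_sum N k) (\<Sum>b<h. if b \<in> B then 1 else 0)"
    unfolding half_sum_def h_def[symmetric] by (intro cong_int2_sum summand) simp
  also have "(\<Sum>b<h. if b \<in> B then 1 else 0) = (of_nat (card B) :: complex)"
  proof -
    have "{..<h} \<inter> B = B"
      using F by (auto simp: B_def)
    then show ?thesis
      by (simp add: sum.If_cases)
  qed
  also have "\<dots> = of_nat (2 * v + 1)"
    unfolding card_B ..
  finally have "cong_int2 (1 - \<chi> 5) (half_sum N k) (of_nat (2 * v + 1))" .
  moreover have "cong_int2 (1 - \<chi> 5) (of_nat (2 * v + 1)) 1"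
    by (rule cong_int2_uniformizer_if_2, rule cong_int2I[of _ _ _ "of_nat v"]) simp_all
  moreover have "cong_int2 (1 - \<chi> 5) (G k / 2) (half_sum N k)"
  proof (rule cong_int2_uniformizer_if_2, rule cong_int2_weaken)
    show "cong_int2 (2 * 2 ^ (N - 2)) (G k / 2) (half_sum N k)"
      using half_G_cong[OF N(1) assms] by (simp only: N(2) power_Suc)
  qed simp
  ultimately show ?thesis
    by (metis cong_int2_trans)
qed


section \<open>The variation of \<open>LL\<close>\<close>

text \<open>\<open>u\<close> is the quotient of the two Euler-type factors; it is 1 modulo 2 because
  \<open>5 ^ (k + 1)\<close> is 1 modulo 4.\<close>

lemma LL_eq_unit_mult_G:
  obtains u where "u * (1 - 5 ^ (k + 1) * \<chi> 5) = 1 - \<chi> 5" "cong_int2 2 u 1"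
    "LL (2 ^ m) \<chi> k = 2 * (u * (G k / 2))"
proof -
  have "[5 ^ (k + 1) = 1 ^ (k + 1)] (mod (4 :: int))"
    by (rule cong_pow) (simp add: cong_def)
  then have "[5 ^ (k + 1) = 1] (mod (4 :: int))"
    by simp
  then obtain u where u: "u * (1 - of_int (5 ^ (k + 1)) * \<chi> 5) = 1 - \<chi> 5" "cong_int2 2 u 1"
    using uniformizer_quotient by blast
  then have "u * (1 - 5 ^ (k + 1) * \<chi> 5) = 1 - \<chi> 5"
    by simp
  moreover from this have "LL (2 ^ m) \<chi> k = 2 * (u * (G k / 2))"
    unfolding LL_def G_def by (simp add: mult.assoc[symmetric] del: power_Suc)
  ultimately show ?thesis
    using u(2) that by blast
qed

text \<open>Since \<open>\<chi> 5\<close> is a unit, the factor \<open>1 / (1 - cnj (\<chi> 5))\<close> of the theorem is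
  \<open>- \<chi> 5 / (1 - \<chi> 5)\<close>; the sign is immaterial at the precision \<open>2 ^ (n + 3)\<close>.\<close>
lemma LL_shift:
  assumes parity: "\<chi> (- 1) \<noteq> (- 1) ^ k" and n: "n \<ge> 1" and q: "odd q"
  defines "w \<equiv> 2 / (1 - \<chi> 5) * (\<chi> 5 * (LL (2 ^ m) \<chi> (k mod 2) / 2))"
  shows "cong_int2 (2 ^ (n + 3)) (LL (2 ^ m) \<chi> (k + 2 ^ n * q) - LL (2 ^ m) \<chi> k) (2 ^ (n + 2) * w)"
    and "cong_int2 (1 - \<chi> 5) (LL (2 ^ m) \<chi> (k mod 2) / 2) 1"
proof -
  define p where "p = 1 - \<chi> 5"
  have p0: "p \<noteq> 0"
    using uniformizer_nonzero by (simp add: p_def)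
  define d where "d = k mod 2"
  define k' where "k' = k + 2 ^ n * q"
  have k: "k = d + 2 ^ 1 * (k div 2)"
    by (simp add: d_def)
  have parity_d: "\<chi> (- 1) \<noteq> (- 1) ^ d"
    using parity by (auto simp: d_def minus_one_power_iff split: if_splits)
  obtain u where u: "u * (1 - 5 ^ (k + 1) * \<chi> 5) = p" "cong_int2 2 u 1"
    "LL (2 ^ m) \<chi> k = 2 * (u * (G k / 2))"
    using LL_eq_unit_mult_G[of k] unfolding p_def by blast
  obtain u' where u': "u' * (1 - 5 ^ (k' + 1) * \<chi> 5) = p" "cong_int2 2 u' 1"
    "LL (2 ^ m) \<chi> k' = 2 * (u' * (G k' / 2))"
    using LL_eq_unit_mult_G[of k'] unfolding p_def by blast
  obtain ud where ud: "cong_int2 2 ud 1" "LL (2 ^ m) \<chi> d = 2 * (ud * (G d / 2))"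
    using LL_eq_unit_mult_G[of d] by blast
  define g g' gd where "g = G k / 2" and "g' = G k' / 2" and "gd = G d / 2"
  have int2: "g \<in> int2" "gd \<in> int2" "u \<in> int2" "u' \<in> int2" "ud \<in> int2"
    using half_G_int2 parity parity_d u(2) u'(2) ud(1) cong_int2_in[of 2 _ 1]
    by (auto simp: g_def gd_def)
  obtain z where z: "z \<in> int2" "g' = g + 2 ^ (n + 2) * z"
    using half_G_cong_shift[OF parity n, of q] unfolding g_def g'_def k'_def by (elim cong_int2E)
  \<comment> \<open>\<open>k\<close> and \<open>d\<close> differ by an even number, so the shift
    congruence applies with exponent 1.\<close>
  have "cong_int2 (2 ^ (1 + 2)) g gd"
    using half_G_cong_shift[OF parity_d, of 1 "k div 2"] k unfolding g_def gd_def by simp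
  then have g_gd: "cong_int2 2 g gd"
    by (intro cong_int2_weaken[of 2 4]) simp_all
  obtain t where t: "(5 :: int) ^ (2 ^ n * q) = 1 + 2 ^ (n + 2) + 2 ^ (n + 3) * t"
    using five_power_cong[OF q, of n] by (metis cong_iff_lin cong_sym)
  define s where "s = 5 ^ (k + 1) * (1 + 2 * t)"
  have "(5 :: int) ^ (k' + 1) = 5 ^ (k + 1) * 5 ^ (2 ^ n * q)"
    unfolding k'_def by (simp flip: power_add)
  also have "\<dots> = 5 ^ (k + 1) + 2 ^ (n + 2) * s"
    unfolding t s_def by (simp add: algebra_simps power_add)
  finally have "of_int (5 ^ (k' + 1)) = (of_int (5 ^ (k + 1) + 2 ^ (n + 2) * s) :: complex)"
    by (simp only:)
  then have c: "5 ^ (k' + 1) = (5 ^ (k + 1) + 2 ^ (n + 2) * of_int s :: complex)"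
    by (simp only: of_int_add of_int_mult of_int_power of_int_numeral)
  have "odd s"
    by (simp add: s_def)
  then have "[s = 1] (mod 2)"
    by (simp add: cong_def odd_iff_mod_2_eq_one)
  from cong_int2_of_int[OF this] have s: "cong_int2 2 (of_int s) 1"
    by simp
  \<comment> \<open>Expressing \<open>p\<close> through each factor in turn leaves only the
    difference of the two powers of 5.\<close>
  have "p * (u' - u) = u * (1 - 5 ^ (k + 1) * \<chi> 5) * u' - u' * (1 - 5 ^ (k' + 1) * \<chi> 5) * u"
    unfolding u(1) u'(1) by (simp add: algebra_simps)
  also have "\<dots> = u * u' * \<chi> 5 * (2 ^ (n + 2) * of_int s)"
    unfolding c by (simp add: algebra_simps)
  finally have diff_u: "u' - u = u * u' * \<chi> 5 * (2 ^ (n + 2) * of_int s) / p"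
    using p0 by (simp add: field_simps)
  have h1: "cong_int2 2 (u * u' * of_int s * g) (1 * 1 * 1 * gd)"
    by (intro cong_int2_mult u u' s g_gd) (simp_all add: int2)
  have h2: "cong_int2 2 (ud * gd) (1 * gd)"
    by (intro cong_int2_mult ud cong_int2_refl) (simp_all add: int2)
  \<comment> \<open>Precision modulo 2 suffices, since this product gets multiplied by
    \<open>2 ^ (n + 2)\<close> times an integral factor. Its replacement \<open>ud * gd\<close> is
    half of \<open>LL\<close> at \<open>d\<close>.\<close>
  have "cong_int2 2 (u * u' * of_int s * g) (ud * gd)"
    by (rule cong_int2_trans[OF h1[unfolded mult_1] cong_int2_sym[OF h2[unfolded mult_1]]])
  then obtain y where y: "y \<in> int2" "u * u' * of_int s * g = ud * gd + 2 * y"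
    by (elim cong_int2E)
  have "LL (2 ^ m) \<chi> k' - LL (2 ^ m) \<chi> k = 2 * u' * (g' - g) + 2 * (u' - u) * g"
    unfolding u(3) u'(3) g_def g'_def by (simp add: algebra_simps)
  also have "\<dots> = 2 ^ (n + 3) * (u' * z) + 2 ^ (n + 2) * (2 / p * (\<chi> 5 * (u * u' * of_int s * g)))"
    unfolding z(2) diff_u by (simp add: power_add)
  also have "\<dots> = 2 ^ (n + 2) * w + 2 ^ (n + 3) * (u' * z + 2 / p * (\<chi> 5 * y))"
    unfolding y(2) w_def d_def[symmetric] p_def[symmetric] ud(2) gd_def
    by (simp add: algebra_simps power_add)
  finally show "cong_int2 (2 ^ (n + 3)) (LL (2 ^ m) \<chi> (k + 2 ^ n * q) - LL (2 ^ m) \<chi> k) (2 ^ (n + 2) * w)"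
    unfolding k'_def[symmetric]
  proof (rule cong_int2I)
    show "u' * z + 2 / p * (\<chi> 5 * y) \<in> int2"
      using two_div_uniformizer unfolding p_def[symmetric]
      by (intro int2_add int2_mult int2 z y chi_int2)
  qed
  have "cong_int2 (1 - \<chi> 5) (ud * gd) (1 * 1)"
    unfolding gd_def
    by (intro cong_int2_mult half_G_cong_1 cong_int2_uniformizer_if_2 ud parity_d int2 int2_1)
  then show "cong_int2 (1 - \<chi> 5) (LL (2 ^ m) \<chi> (k mod 2) / 2) 1"
    unfolding d_def[symmetric] ud(2) gd_def by simp
qed

lemma LL_congruence:
  assumes parity: "\<chi> (- 1) \<noteq> (- 1) ^ k" and n: "n \<ge> 1" and q: "odd q"
  shows "cong2 (LL (2 ^ m) \<chi> (k + 2 ^ n * q) - LL (2 ^ m) \<chi> k)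
    (2 ^ (n + 2) / (1 - cnj (\<chi> 5)) * LL (2 ^ m) \<chi> (k mod 2)) (n + 3)"
proof -
  define e where "e = LL (2 ^ m) \<chi> (k mod 2) / 2"
  have chi5: "\<chi> 5 \<noteq> 0"
    by (simp add: chi_eq_0_iff)
  have "e \<in> int2"
    using LL_shift(2)[OF parity n q] unfolding e_def by (rule cong_int2_in) simp_all
  have "1 - cnj (\<chi> 5) = - (1 - \<chi> 5) / \<chi> 5"
    using chi5 by (simp add: cnj_chi_5 field_simps)
  moreover have "a / (- p / z) * (2 * e) = - (a * (2 / p * (z * e)))" if "p \<noteq> 0" "z \<noteq> 0" for a p z :: complex
    using that by (simp add: field_simps)
  moreover have "LL (2 ^ m) \<chi> (k mod 2) = 2 * e"
    by (simp add: e_def)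
  ultimately have "2 ^ (n + 2) / (1 - cnj (\<chi> 5)) * LL (2 ^ m) \<chi> (k mod 2) =
      - (2 ^ (n + 2) * (2 / (1 - \<chi> 5) * (\<chi> 5 * e)))"
    using uniformizer_nonzero chi5 by (simp only:)
  \<comment> \<open>Changing the sign costs twice the term, a multiple of
    \<open>2 ^ (n + 3)\<close>.\<close>
  moreover have "2 ^ (n + 2) * (2 / (1 - \<chi> 5) * (\<chi> 5 * e)) =
      - (2 ^ (n + 2) * (2 / (1 - \<chi> 5) * (\<chi> 5 * e))) + 2 ^ (n + 3) * (2 / (1 - \<chi> 5) * (\<chi> 5 * e))"
    by (simp add: power_add)
  then have "cong_int2 (2 ^ (n + 3)) (2 ^ (n + 2) * (2 / (1 - \<chi> 5) * (\<chi> 5 * e)))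
      (- (2 ^ (n + 2) * (2 / (1 - \<chi> 5) * (\<chi> 5 * e))))"
    by (rule cong_int2I) (intro int2_mult two_div_uniformizer chi_int2 \<open>e \<in> int2\<close>)
  ultimately show ?thesis
    using cong_int2_trans[OF LL_shift(1)[OF parity n q]]
    by (simp only: cong2_iff_cong_int2 e_def)
qed

text \<open>The difference is \<open>2 ^ (j + 2) * (w + 2 * y)\<close>, where
  \<open>(1 - \<chi> 5) * w\<close> is 2 times an element that is 1 modulo
  \<open>1 - \<chi> 5\<close>. If 2 divided \<open>w\<close>, then \<open>1 - \<chi> 5\<close> would
  divide that element; so the difference is not divisible by \<open>2 ^ (j + 3)\<close>.\<close>

lemma LL_cong_iff_shift:
  assumes parity: "\<chi> (- 1) \<noteq> (- 1) ^ k" and j: "j \<ge> 1" and q: "odd q"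
  shows "cong2 (LL (2 ^ m) \<chi> (k + 2 ^ j * q)) (LL (2 ^ m) \<chi> k) (n + 2) \<longleftrightarrow> n \<le> j"
proof -
  define e where "e = LL (2 ^ m) \<chi> (k mod 2) / 2"
  have e1: "cong_int2 (1 - \<chi> 5) e 1"
    using LL_shift(2)[OF parity j q] by (simp only: e_def)
  then have e: "e \<in> int2"
    by (rule cong_int2_in) simp_all
  define w where "w = 2 / (1 - \<chi> 5) * (\<chi> 5 * e)"
  have w: "w \<in> int2"
    unfolding w_def by (intro int2_mult two_div_uniformizer chi_int2 e)
  have "(1 - \<chi> 5) * w = 2 * (\<chi> 5 * e)"
    using uniformizer_nonzero by (simp add: w_def)
  obtain y where y: "y \<in> int2"
    "LL (2 ^ m) \<chi> (k + 2 ^ j * q) - LL (2 ^ m) \<chi> k = 2 ^ (j + 2) * w + 2 ^ (j + 3) * y"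
    using LL_shift(1)[OF parity j q] unfolding w_def e_def by (elim cong_int2E)
  then have diff: "LL (2 ^ m) \<chi> (k + 2 ^ j * q) = LL (2 ^ m) \<chi> k + 2 ^ (j + 2) * (w + 2 * y)"
    by (simp add: algebra_simps power_add)
  show ?thesis
  proof
    assume "n \<le> j"
    then have "2 ^ (j + 2) = (2 ^ (n + 2) * 2 ^ (j - n) :: complex)"
      by (simp flip: power_add)
    then have "LL (2 ^ m) \<chi> (k + 2 ^ j * q) = LL (2 ^ m) \<chi> k + 2 ^ (n + 2) * (2 ^ (j - n) * (w + 2 * y))"
      using diff by (simp only: mult.assoc)
    then show "cong2 (LL (2 ^ m) \<chi> (k + 2 ^ j * q)) (LL (2 ^ m) \<chi> k) (n + 2)"
      unfolding cong2_iff_cong_int2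
      by (rule cong_int2I) (intro int2_mult int2_power int2_add w y int2_numeral)
  next
    assume cong: "cong2 (LL (2 ^ m) \<chi> (k + 2 ^ j * q)) (LL (2 ^ m) \<chi> k) (n + 2)"
    show "n \<le> j"
    proof (rule ccontr)
      assume "\<not> n \<le> j"
      then have split: "n + 2 = (j + 2) + 1 + (n - j - 1)"
        by simp
      have "2 ^ (n + 2) = (2 ^ (j + 2) * 2 * 2 ^ (n - j - 1) :: complex)"
        by (subst split) (simp only: power_add power_one_right)
      moreover obtain x where x: "x \<in> int2"
        "LL (2 ^ m) \<chi> (k + 2 ^ j * q) = LL (2 ^ m) \<chi> k + 2 ^ (n + 2) * x"
        using cong unfolding cong2_iff_cong_int2 by (elim cong_int2E)
      ultimately have "2 ^ (j + 2) * (w + 2 * y) = 2 ^ (j + 2) * (2 * 2 ^ (n - j - 1) * x)"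
        using diff by (simp only: mult.assoc add_left_cancel)
      moreover have "(2 :: complex) ^ (j + 2) \<noteq> 0"
        by simp
      ultimately have "w + 2 * y = 2 * 2 ^ (n - j - 1) * x"
        by (metis mult_left_cancel)
      then have "w = 2 * (2 ^ (n - j - 1) * x - y)"
        by (simp add: algebra_simps)
      then have "2 * (\<chi> 5 * e) = 2 * ((1 - \<chi> 5) * (2 ^ (n - j - 1) * x - y))"
        using \<open>(1 - \<chi> 5) * w = 2 * (\<chi> 5 * e)\<close> by (metis mult.left_commute)
      then have "\<chi> 5 * e = 0 + (1 - \<chi> 5) * (2 ^ (n - j - 1) * x - y)"
        by (metis add_0 mult_left_cancel zero_neq_numeral)
      then have "cong_int2 (1 - \<chi> 5) (\<chi> 5 * e) 0"
        by (rule cong_int2I) (intro int2_diff int2_mult int2_power int2_numeral x y)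
      moreover have "cong_int2 (1 - \<chi> 5) (\<chi> 5 * e) (1 * 1)"
        by (intro cong_int2_mult chi_cong_1 e1 chi_int2 int2_1) simp
      ultimately have "cong_int2 (1 - \<chi> 5) (1 * 1) 0"
        by (metis cong_int2_sym cong_int2_trans)
      with not_cong_int2_1_0 show False
        by simp
    qed
  qed
qed

lemma LL_cong_iff_less:
  assumes "\<chi> (- 1) \<noteq> (- 1) ^ k" "\<chi> (- 1) \<noteq> (- 1) ^ l" "l < k"
  shows "cong2 (LL (2 ^ m) \<chi> k) (LL (2 ^ m) \<chi> l) (n + 2) \<longleftrightarrow> [k = l] (mod 2 ^ n)"
proof -
  \<comment> \<open>\<open>j\<close> is the exact power of 2 in \<open>k - l\<close>; it is positive
    because the parity condition forces \<open>k\<close> and \<open>l\<close> to have equal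
    parity.\<close>
  define j where "j = multiplicity 2 (k - l)"
  obtain q where q: "k - l = 2 ^ j * q" "odd q"
    using multiplicity_decompose'[of "k - l" 2] assms(3) by (auto simp: j_def)
  have k: "k = l + 2 ^ j * q"
    using q(1) assms(3) by simp
  have "even k \<longleftrightarrow> even l"
    using assms(1,2) chi_minus_1 by (auto simp: minus_one_power_iff split: if_splits)
  then have "even (k - l)"
    by simp
  then have "even (2 ^ j * q)"
    by (simp only: q(1))
  then have "j \<ge> 1"
    using q(2) by (cases j) auto
  have "[k = l] (mod 2 ^ n) \<longleftrightarrow> 2 ^ n dvd k - l"
    using assms(3) by (simp add: cong_altdef_nat)
  also have "\<dots> \<longleftrightarrow> n \<le> j"
    unfolding j_def using assms(3) by (intro power_dvd_iff_le_multiplicity) auto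
  finally show ?thesis
    using LL_cong_iff_shift[OF assms(2) \<open>j \<ge> 1\<close> q(2), of n] by (simp only: k)
qed

lemma LL_cong_iff:
  assumes "\<chi> (- 1) \<noteq> (- 1) ^ k" "\<chi> (- 1) \<noteq> (- 1) ^ l"
  shows "cong2 (LL (2 ^ m) \<chi> k) (LL (2 ^ m) \<chi> l) (n + 2) \<longleftrightarrow> [k = l] (mod 2 ^ n)"
proof (cases k l rule: linorder_cases)
  case less
  then show ?thesis
    using LL_cong_iff_less[OF assms(2,1)] cong_int2_sym cong_sym
    unfolding cong2_iff_cong_int2 by metis
next
  case equal
  then show ?thesis
    by (simp add: cong2_iff_cong_int2)
next
  case greater
  then show ?thesis
    using LL_cong_iff_less[OF assms] by simp
qed

end

theorem theorem1p1:
  fixes m :: nat and \<chi> :: "int \<Rightarrow> complex" and n :: nat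
  assumes "m \<ge> 3" and "primitive_char (2 ^ m) \<chi>" and "n \<ge> 1"
  shows "(\<forall>(q::nat) (k::nat). odd q \<longrightarrow> \<chi> (-1) \<noteq> (-1) ^ k \<longrightarrow>
            cong2 (LL (2 ^ m) \<chi> (k + 2 ^ n * q) - LL (2 ^ m) \<chi> k)
                  (2 ^ (n + 2) / (1 - cnj (\<chi> 5)) * LL (2 ^ m) \<chi> (k mod 2))
                  (n + 3))
       \<and> (\<forall>(k::nat) (l::nat). \<chi> (-1) \<noteq> (-1) ^ k \<longrightarrow> \<chi> (-1) \<noteq> (-1) ^ l \<longrightarrow>
            (cong2 (LL (2 ^ m) \<chi> k) (LL (2 ^ m) \<chi> l) (n + 2) \<longleftrightarrow> [k = l] (mod 2 ^ n)))"
proof -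
  interpret two_power_char m \<chi>
    using assms by unfold_locales
  show ?thesis
    using LL_congruence LL_cong_iff assms(3) by blast
qed

end
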